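(* Let $A$ and $B$ be two irreducible square matrices with entries in $\{0,1\}$ satisfying condition (I). Let $\Gamma_A$ and $\Gamma_B$ be the continuous full groups of the one-sided topological Markov shifts $(X_A,\sigma_A)$ and $(X_B,\sigma_B)$. Then the following two conditions are equivalent: (i) $\Gamma_A$ and $\Gamma_B$ are isomorphic as abstract groups. (ii) $\Gamma_A$ and $\Gamma_B$ are spatially isomorphic, i.e. there exists a homeomorphism $h: X_A \to X_B$ such that $h\circ \Gamma_A\circ h^{-1} = \Gamma_B$.
   Context: For an $N\times N$ matrix $A$ with entries in $\{0,1\}$ ($N>1$, no zero rows or columns), $X_A=\{(x_n)_{n\in\mathbb{N}}\in\{1,\dots,N\}^{\mathbb{N}} : A(x_n,x_{n+1})=1 \text{ for all } n\in\mathbb{N}\}$ with the product topology (a compact Hausdorff space), and $\sigma_A:X_A\to X_A$ is the shift $\sigma_A((x_n)_n)=(x_{n+1})_n$, a continuous surjection. Condition (I) for $A$ is equivalent to $X_A$ being homeomorphic to a Cantor set (for irreducible $A$: $A$ is not a permutation matrix). The continuous full group $\Gamma_A$ is the group of all homeomorphisms $\tau$ of $X_A$ for which there exist continuous functions $k,l:X_A\to\mathbb{Z}_{+}=\{0,1,2,\dots\}$ with $\sigma_A^{k(x)}(\tau(x))=\sigma_A^{l(x)}(x)$ for all $x\in X_A$. *)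

theory Defs
  imports
    "HOL-Analysis.Function_Topology"
    "HOL-Analysis.Product_Topology"
    "HOL-Algebra.Bij"
    "Jordan_Normal_Form.Matrix"
begin

text \<open>Library matrices are indexed from \<open>0\<close>, so the alphabet of an \<open>N\<times>N\<close> matrix is
  \<open>{0..<N}\<close> instead of \<open>{1..N}\<close>.\<close>

definition zero_one_matrix :: "nat \<Rightarrow> nat mat \<Rightarrow> bool" where
  "zero_one_matrix N A \<longleftrightarrow>
     1 < N \<and> A \<in> carrier_mat N N \<and>
     (\<forall>i<N. \<forall>j<N. A $$ (i, j) \<in> {0, 1}) \<and>
     (\<forall>i<N. row A i \<noteq> 0\<^sub>v N) \<and> (\<forall>j<N. col A j \<noteq> 0\<^sub>v N)"

definition irreducible_matrix :: "nat mat \<Rightarrow> bool" where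
  "irreducible_matrix A \<longleftrightarrow>
     (\<forall>i<dim_row A. \<forall>j<dim_row A. \<exists>n>0. (A ^\<^sub>m n) $$ (i, j) > 0)"

definition markov_space :: "nat mat \<Rightarrow> (nat \<Rightarrow> nat) topology" where
  "markov_space A =
     subtopology (product_topology (\<lambda>_. discrete_topology {0..<dim_row A}) UNIV)
       {x. \<forall>n. A $$ (x n, x (Suc n)) = 1}"

definition shift :: "(nat \<Rightarrow> 'a) \<Rightarrow> (nat \<Rightarrow> 'a)" where
  "shift x = (\<lambda>n. x (Suc n))"

definition cantor_space :: "(nat \<Rightarrow> bool) topology" where
  "cantor_space = product_topology (\<lambda>_. discrete_topology UNIV) UNIV"

text \<open>For a zero-one matrix without zero rows and columns, condition (I) of Cuntz and Krieger says
  precisely that the shift space is a Cantor set; this is the form taken as definition here.\<close>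

definition condition_I :: "nat mat \<Rightarrow> bool" where
  "condition_I A \<longleftrightarrow> markov_space A homeomorphic_space cantor_space"

text \<open>Self-maps of the shift space are represented by their extensional representatives, as in
  \<^const>\<open>BijGroup\<close>, so that equality of functions is equality of maps on the space.\<close>

definition full_group_set :: "nat mat \<Rightarrow> ((nat \<Rightarrow> nat) \<Rightarrow> (nat \<Rightarrow> nat)) set" where
  "full_group_set A =
     {\<tau> \<in> extensional (topspace (markov_space A)).
        homeomorphic_map (markov_space A) (markov_space A) \<tau> \<and>
        (\<exists>k l. continuous_map (markov_space A) (discrete_topology (UNIV :: nat set)) k \<and>
               continuous_map (markov_space A) (discrete_topology (UNIV :: nat set)) l \<and>
               (\<forall>x\<in>topspace (markov_space A). (shift ^^ k x) (\<tau> x) = (shift ^^ l x) x))}"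

definition full_group :: "nat mat \<Rightarrow> ((nat \<Rightarrow> nat) \<Rightarrow> (nat \<Rightarrow> nat)) monoid" where
  "full_group A = BijGroup (topspace (markov_space A)) \<lparr>carrier := full_group_set A\<rparr>"

definition conjugate_map ::
    "'a topology \<Rightarrow> 'b topology \<Rightarrow> ('a \<Rightarrow> 'b) \<Rightarrow> ('a \<Rightarrow> 'a) \<Rightarrow> ('b \<Rightarrow> 'b)" where
  "conjugate_map X Y h \<tau> =
     restrict (h \<circ> \<tau> \<circ> inv_into (topspace X) h) (topspace Y)"

definition spatially_isomorphic :: "nat mat \<Rightarrow> nat mat \<Rightarrow> bool" where
  "spatially_isomorphic A B \<longleftrightarrow>
     (\<exists>h. homeomorphic_map (markov_space A) (markov_space B) h \<and>
          conjugate_map (markov_space A) (markov_space B) h ` full_group_set A = full_group_set B)"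

lemma full_group_setI:
  assumes "\<tau> \<in> extensional (topspace (markov_space A))"
    and "homeomorphic_map (markov_space A) (markov_space A) \<tau>"
    and "continuous_map (markov_space A) (discrete_topology (UNIV :: nat set)) k"
    and "continuous_map (markov_space A) (discrete_topology (UNIV :: nat set)) l"
    and "\<And>x. x \<in> topspace (markov_space A) \<Longrightarrow> (shift ^^ k x) (\<tau> x) = (shift ^^ l x) x"
  shows "\<tau> \<in> full_group_set A"
  unfolding full_group_set_def mem_Collect_eq
  by (intro conjI exI[of _ k] exI[of _ l] ballI assms)

lemma full_group_set_subset_Bij:
  "full_group_set A \<subseteq> Bij (topspace (markov_space A))"
proof
  fix \<tau> assume "\<tau> \<in> full_group_set A"
  then have "\<tau> \<in> extensional (topspace (markov_space A))"
    and h: "homeomorphic_map (markov_space A) (markov_space A) \<tau>"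
    by (simp_all add: full_group_set_def)
  then show "\<tau> \<in> Bij (topspace (markov_space A))"
    using homeomorphic_imp_injective_map[OF h] homeomorphic_imp_surjective_map[OF h]
    by (simp add: Bij_def bij_betw_def)
qed

lemma continuous_map_discrete_add:
  assumes "continuous_map X (discrete_topology (UNIV :: nat set)) f"
    and "continuous_map X (discrete_topology (UNIV :: nat set)) g"
  shows "continuous_map X (discrete_topology (UNIV :: nat set)) (\<lambda>x. f x + g x)"
proof -
  have "continuous_map X (prod_topology (discrete_topology UNIV) (discrete_topology UNIV))
          (\<lambda>x. (f x, g x))"
    using assms by (simp add: continuous_map_pairwise o_def)
  then have "continuous_map X (discrete_topology (UNIV :: (nat \<times> nat) set)) (\<lambda>x. (f x, g x))"
    by (simp flip: prod_topology_discrete_topology UNIV_Times_UNIV)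
  moreover have "continuous_map (discrete_topology (UNIV :: (nat \<times> nat) set))
      (discrete_topology UNIV) (\<lambda>(a, b). a + b)"
    by simp
  ultimately have "continuous_map X (discrete_topology UNIV) ((\<lambda>(a, b). a + b) \<circ> (\<lambda>x. (f x, g x)))"
    by (rule continuous_map_compose)
  then show ?thesis by (simp add: o_def)
qed

lemma full_group_set_compose:
  assumes g: "g \<in> full_group_set A" and f: "f \<in> full_group_set A"
  shows "compose (topspace (markov_space A)) g f \<in> full_group_set A"
proof -
  let ?X = "markov_space A" and ?D = "discrete_topology (UNIV :: nat set)"
  have hf: "homeomorphic_map ?X ?X f" and hg: "homeomorphic_map ?X ?X g"
    using f g by (auto simp: full_group_set_def)
  obtain k1 l1 where 1: "continuous_map ?X ?D k1" "continuous_map ?X ?D l1"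
      "\<And>x. x \<in> topspace ?X \<Longrightarrow> (shift ^^ k1 x) (f x) = (shift ^^ l1 x) x"
    using f by (auto simp: full_group_set_def)
  obtain k2 l2 where 2: "continuous_map ?X ?D k2" "continuous_map ?X ?D l2"
      "\<And>x. x \<in> topspace ?X \<Longrightarrow> (shift ^^ k2 x) (g x) = (shift ^^ l2 x) x"
    using g by (auto simp: full_group_set_def)
  have cf: "continuous_map ?X ?X f" using hf homeomorphic_imp_continuous_map by blast
  have "homeomorphic_map ?X ?X (g \<circ> f)" using hf hg homeomorphic_map_compose by blast
  then have h: "homeomorphic_map ?X ?X (compose (topspace ?X) g f)"
    by (rule homeomorphic_map_eq) (simp add: compose_def)
  have k: "continuous_map ?X ?D (\<lambda>x. k1 x + k2 (f x))"
    using continuous_map_discrete_add[OF 1(1) continuous_map_compose[OF cf 2(1)]] by (simp add: o_def)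
  have l: "continuous_map ?X ?D (\<lambda>x. l2 (f x) + l1 x)"
    using continuous_map_discrete_add[OF continuous_map_compose[OF cf 2(2)] 1(2)] by (simp add: o_def)
  have eq: "(shift ^^ (k1 x + k2 (f x))) (compose (topspace ?X) g f x)
      = (shift ^^ (l2 (f x) + l1 x)) x" if x: "x \<in> topspace ?X" for x
  proof -
    have fx: "f x \<in> topspace ?X" using cf x by (auto simp: continuous_map_def)
    have "(shift ^^ (k1 x + k2 (f x))) (g (f x)) = (shift ^^ k1 x) ((shift ^^ l2 (f x)) (f x))"
      by (simp add: funpow_add 2(3)[OF fx])
    also have "\<dots> = (shift ^^ l2 (f x)) ((shift ^^ k1 x) (f x))"
      by (metis add.commute comp_apply funpow_add)
    also have "\<dots> = (shift ^^ (l2 (f x) + l1 x)) x"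
      by (simp add: funpow_add 1(3)[OF x])
    finally show ?thesis using x by (simp add: compose_def)
  qed
  show ?thesis
    by (rule full_group_setI[OF compose_extensional h k l eq])
qed

lemma full_group_set_inv:
  assumes f: "f \<in> full_group_set A"
  shows "restrict (inv_into (topspace (markov_space A)) f) (topspace (markov_space A)) \<in> full_group_set A"
    (is "?g \<in> _")
proof -
  let ?X = "markov_space A" and ?D = "discrete_topology (UNIV :: nat set)"
  have hf: "homeomorphic_map ?X ?X f" using f by (auto simp: full_group_set_def)
  obtain k l where 1: "continuous_map ?X ?D k" "continuous_map ?X ?D l"
      "\<And>x. x \<in> topspace ?X \<Longrightarrow> (shift ^^ k x) (f x) = (shift ^^ l x) x"
    using f by (auto simp: full_group_set_def)
  obtain g where fg: "homeomorphic_maps ?X ?X f g" using hf homeomorphic_map_maps by blast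
  have gX: "g y \<in> topspace ?X" if "y \<in> topspace ?X" for y
    using fg that by (auto simp: homeomorphic_maps_def continuous_map_def)
  have fgy: "f (g y) = y" if "y \<in> topspace ?X" for y
    using fg that by (auto simp: homeomorphic_maps_def)
  have inj: "inj_on f (topspace ?X)" using hf homeomorphic_imp_injective_map by blast
  have geq: "g y = ?g y" if "y \<in> topspace ?X" for y
    using that inv_into_f_f[OF inj gX[OF that]] fgy[OF that] by simp
  have hg: "homeomorphic_map ?X ?X g" using fg homeomorphic_maps_map by blast
  have cg: "continuous_map ?X ?X g" using hg homeomorphic_imp_continuous_map by blast
  have h: "homeomorphic_map ?X ?X ?g" using hg geq by (rule homeomorphic_map_eq)
  have c: "continuous_map ?X ?D (l \<circ> g)" "continuous_map ?X ?D (k \<circ> g)"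
    using continuous_map_compose[OF cg 1(2)] continuous_map_compose[OF cg 1(1)] by simp_all
  have "(shift ^^ (l \<circ> g) y) (?g y) = (shift ^^ (k \<circ> g) y) y" if y: "y \<in> topspace ?X" for y
    using 1(3)[OF gX[OF y]] fgy[OF y] geq[OF y] by simp
  then show ?thesis
    by (rule full_group_setI[OF restrict_extensional h c])
qed

lemma subgroup_full_group_set:
  "subgroup (full_group_set A) (BijGroup (topspace (markov_space A)))"
proof (rule group.subgroupI[OF group_BijGroup])
  let ?X = "markov_space A"
  show "full_group_set A \<subseteq> carrier (BijGroup (topspace ?X))"
    using full_group_set_subset_Bij by (simp add: BijGroup_def)
  have id: "homeomorphic_map ?X ?X (\<lambda>x\<in>topspace ?X. x)"
    by (rule homeomorphic_map_eq[of _ _ id]) auto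
  have "(\<lambda>x\<in>topspace ?X. x) \<in> full_group_set A"
    by (rule full_group_setI[where k = "\<lambda>_. 0" and l = "\<lambda>_. 0", OF _ id]) simp_all
  then show "full_group_set A \<noteq> {}" by blast
next
  fix f assume "f \<in> full_group_set A"
  then show "inv\<^bsub>BijGroup (topspace (markov_space A))\<^esub> f \<in> full_group_set A"
    using full_group_set_inv full_group_set_subset_Bij by (simp add: inv_BijGroup subset_iff)
next
  fix f g assume "f \<in> full_group_set A" "g \<in> full_group_set A"
  then show "f \<otimes>\<^bsub>BijGroup (topspace (markov_space A))\<^esub> g \<in> full_group_set A"
    using full_group_set_compose full_group_set_subset_Bij by (simp add: BijGroup_def subset_iff)
qed

lemma group_full_group: "group (full_group A)"
  unfolding full_group_def
  by (rule subgroup.subgroup_is_group[OF subgroup_full_group_set group_BijGroup])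

end

theory Submission
  imports Defs "HOL-Algebra.Group_Action" "HOL-Analysis.Abstract_Topological_Spaces"
begin

text \<open>
  A group isomorphism must be induced by a homeomorphism because the supports of group elements can
  be compared in purely group-theoretic terms, following Rubin and the short proof of Rubin's theorem
  by Belk, Elliott and Matucci. If \<open>f\<close> and \<open>g\<close> have disjoint supports and \<open>h\<close> does not commute with
  \<open>f\<close>, then suitable \<open>a, b\<close> supported inside the support of \<open>f\<close>, hence commuting with \<open>g\<close>, make
  \<open>[a, [b, h]]\<close> a nontrivial element commuting with \<open>g\<close>. Conversely this algebraic property forces the
  supports of \<open>f\<close> and \<open>g\<^sup>1\<^sup>2\<close> to be disjoint. Inclusion of closed supports is then detected by
  commutation with such powers. In a continuous full group all closed supports are clopen and form a
  base of the shift space: an involution exchanging two incomparable words that end in the same letter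
  moves any given point while being supported in any given neighbourhood of it. By compactness, the
  points of the space are the maximal families of elements whose supports have the finite intersection
  property, and the isomorphism carries these families to each other.
\<close>

subsection \<open>Supports in terms of the abstract group\<close>

definition commutator :: "('a, 'b) monoid_scheme \<Rightarrow> 'a \<Rightarrow> 'a \<Rightarrow> 'a" where
  "commutator G a b = a \<otimes>\<^bsub>G\<^esub> b \<otimes>\<^bsub>G\<^esub> inv\<^bsub>G\<^esub> a \<otimes>\<^bsub>G\<^esub> inv\<^bsub>G\<^esub> b"

definition commuting :: "('a, 'b) monoid_scheme \<Rightarrow> 'a \<Rightarrow> 'a \<Rightarrow> bool" where
  "commuting G a b \<longleftrightarrow> a \<otimes>\<^bsub>G\<^esub> b = b \<otimes>\<^bsub>G\<^esub> a"

text \<open>The arguments play different roles: \<open>f\<close> provides room for \<open>a\<close>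
  and \<open>b\<close>, and \<open>g\<close> is what they must commute with. Disjoint supports imply
  the relation; what is recovered from it is that the points moved by \<open>f\<close> avoid those
  moved by \<open>g [^] 12\<close>.\<close>

definition alg_disjoint :: "('a, 'b) monoid_scheme \<Rightarrow> 'a \<Rightarrow> 'a \<Rightarrow> bool" where
  "alg_disjoint G g f \<longleftrightarrow>
     (\<forall>h\<in>carrier G. \<not> commuting G f h \<longrightarrow>
        (\<exists>a\<in>carrier G. \<exists>b\<in>carrier G. commuting G a g \<and> commuting G b g \<and>
           commutator G a (commutator G b h) \<noteq> \<one>\<^bsub>G\<^esub> \<and>
           commuting G (commutator G a (commutator G b h)) g))"

text \<open>The exponent is divisible by \<open>1, 2, 3, 4\<close>, so \<open>x, g x, \<dots>, g\<^sup>4 x\<close> are distinct as soon as \<open>g\<^sup>1\<^sup>2\<close>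
  moves \<open>x\<close>.\<close>

definition alg_supp_le :: "('a, 'b) monoid_scheme \<Rightarrow> 'a \<Rightarrow> 'a \<Rightarrow> bool" where
  "alg_supp_le G f f' \<longleftrightarrow>
     (\<forall>g\<in>carrier G. alg_disjoint G g f' \<longrightarrow> commuting G f (g [^]\<^bsub>G\<^esub> (12::nat)))"

text \<open>A nontrivial \<open>k\<close> below all of \<open>E\<close> witnesses that the supports
  of \<open>E\<close> have a common point, so this is the finite intersection property expressed
  without points.\<close>

definition centered :: "('a, 'b) monoid_scheme \<Rightarrow> 'a set \<Rightarrow> bool" where
  "centered G F \<longleftrightarrow> F \<subseteq> carrier G \<and>
     (\<forall>E. finite E \<and> E \<subseteq> F \<longrightarrow>
        (\<exists>k\<in>carrier G. k \<noteq> \<one>\<^bsub>G\<^esub> \<and> (\<forall>e\<in>E. alg_supp_le G k e)))"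

definition max_centered :: "('a, 'b) monoid_scheme \<Rightarrow> 'a set \<Rightarrow> bool" where
  "max_centered G F \<longleftrightarrow> centered G F \<and> (\<forall>F'. centered G F' \<and> F \<subseteq> F' \<longrightarrow> F' = F)"

lemma centered_subset: "centered G F \<Longrightarrow> F \<subseteq> carrier G"
  by (simp add: centered_def)

lemma max_centeredD:
  assumes "max_centered G F"
  shows "centered G F" "\<lbrakk>centered G F'; F \<subseteq> F'\<rbrakk> \<Longrightarrow> F' = F"
  using assms unfolding max_centered_def by blast+

section \<open>Transfer of the algebraic relations along an isomorphism\<close>

locale group_iso_pair =
  G?: group G + H?: group H for G (structure) and H (structure) +
  fixes \<psi> \<psi>'
  assumes isos: "group_isomorphisms G H \<psi> \<psi>'"
begin

lemma closed: "g \<in> carrier G \<Longrightarrow> \<psi> g \<in> carrier H" "h \<in> carrier H \<Longrightarrow> \<psi>' h \<in> carrier G"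
  and inverse: "g \<in> carrier G \<Longrightarrow> \<psi>' (\<psi> g) = g" "h \<in> carrier H \<Longrightarrow> \<psi> (\<psi>' h) = h"
  using isos by (auto simp: group_isomorphisms_def hom_def Pi_iff)

text \<open>The symmetry allows each transfer below to be proved in one direction and then applied
  to \<open>\<psi>'\<close>.\<close>

lemma flip: "group_iso_pair H G \<psi>' \<psi>"
  using isos by (auto simp: group_iso_pair_def group_iso_pair_axioms_def group_isomorphisms_def
      G.is_group H.is_group)

sublocale hom: group_hom G H \<psi>
  using isos by (auto simp: group_hom_def group_hom_axioms_def group_isomorphisms_def
      G.is_group H.is_group)

lemma inj: "\<lbrakk>g \<in> carrier G; h \<in> carrier G\<rbrakk> \<Longrightarrow> \<psi> g = \<psi> h \<longleftrightarrow> g = h"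
  using inverse(1) by metis

lemma inj_on: "inj_on \<psi> (carrier G)"
  by (rule inj_onI) (simp add: inj)

lemma map_commuting:
  "\<lbrakk>a \<in> carrier G; b \<in> carrier G\<rbrakk> \<Longrightarrow> commuting H (\<psi> a) (\<psi> b) \<longleftrightarrow> commuting G a b"
  by (simp add: commuting_def inj flip: hom.hom_mult)

lemma map_commutator:
  "\<lbrakk>a \<in> carrier G; b \<in> carrier G\<rbrakk> \<Longrightarrow>
     commutator H (\<psi> a) (\<psi> b) = \<psi> (commutator G a b)"
  by (simp add: commutator_def)

lemma map_eq_one: "g \<in> carrier G \<Longrightarrow> \<psi> g = \<one>\<^bsub>H\<^esub> \<longleftrightarrow> g = \<one>"
  using inj[of g \<one>] by simp

lemma map_alg_disjoint_imp:
  assumes fg: "f \<in> carrier G" "g \<in> carrier G" and "alg_disjoint G g f"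
  shows "alg_disjoint H (\<psi> g) (\<psi> f)"
  unfolding alg_disjoint_def
proof (intro ballI impI)
  fix h assume h: "h \<in> carrier H" and nc: "\<not> commuting H (\<psi> f) h"
  define k where "k = \<psi>' h"
  have k: "k \<in> carrier G" "h = \<psi> k" using h closed inverse by (auto simp: k_def)
  have "\<not> commuting G f k" using nc k fg map_commuting by auto
  then obtain a b where ab: "a \<in> carrier G" "b \<in> carrier G" "commuting G a g" "commuting G b g"
     "commutator G a (commutator G b k) \<noteq> \<one>" "commuting G (commutator G a (commutator G b k)) g"
    using assms(3) k unfolding alg_disjoint_def by blast
  have c: "commutator G b k \<in> carrier G" "commutator G a (commutator G b k) \<in> carrier G"
    using ab k by (auto simp: commutator_def)
  have "commutator H (\<psi> a) (commutator H (\<psi> b) h) = \<psi> (commutator G a (commutator G b k))"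
    using ab k c by (simp add: map_commutator)
  then show "\<exists>a\<in>carrier H. \<exists>b\<in>carrier H. commuting H a (\<psi> g) \<and> commuting H b (\<psi> g) \<and>
           commutator H a (commutator H b h) \<noteq> \<one>\<^bsub>H\<^esub> \<and>
           commuting H (commutator H a (commutator H b h)) (\<psi> g)"
    using ab c fg map_commuting map_eq_one closed by metis
qed

lemma map_alg_disjoint:
  assumes "f \<in> carrier G" "g \<in> carrier G"
  shows "alg_disjoint H (\<psi> g) (\<psi> f) \<longleftrightarrow> alg_disjoint G g f"
  using map_alg_disjoint_imp assms group_iso_pair.map_alg_disjoint_imp[OF flip] closed inverse
  by metis

lemma map_alg_supp_le_imp:
  assumes f: "f \<in> carrier G" "f' \<in> carrier G" and le: "alg_supp_le G f f'"
  shows "alg_supp_le H (\<psi> f) (\<psi> f')"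
  unfolding alg_supp_le_def
proof (intro ballI impI)
  fix h assume h: "h \<in> carrier H" and d: "alg_disjoint H h (\<psi> f')"
  define k where "k = \<psi>' h"
  have k: "k \<in> carrier G" "h = \<psi> k" using h closed inverse by (auto simp: k_def)
  then have "alg_disjoint G k f'" using d f map_alg_disjoint by auto
  then have "commuting G f (k [^] (12::nat))" using le k unfolding alg_supp_le_def by auto
  then show "commuting H (\<psi> f) (h [^]\<^bsub>H\<^esub> (12::nat))"
    using f k map_commuting[of f "k [^] (12::nat)"] by (simp add: hom.hom_nat_pow)
qed

lemma map_centered_imp:
  assumes F: "centered G F"
  shows "centered H (\<psi> ` F)"
  unfolding centered_def
proof (intro conjI allI impI)
  have sub: "F \<subseteq> carrier G" using centered_subset[OF F] .
  then show "\<psi> ` F \<subseteq> carrier H" using closed by auto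
  fix E assume "finite E \<and> E \<subseteq> \<psi> ` F"
  then obtain D where D: "D \<subseteq> F" "finite D" "E = \<psi> ` D"
    by (meson finite_subset_image)
  then obtain k where k: "k \<in> carrier G" "k \<noteq> \<one>" "\<forall>e\<in>D. alg_supp_le G k e"
    using F unfolding centered_def by blast
  then have "\<forall>e\<in>E. alg_supp_le H (\<psi> k) e"
    using D sub map_alg_supp_le_imp by auto
  then show "\<exists>k\<in>carrier H. k \<noteq> \<one>\<^bsub>H\<^esub> \<and> (\<forall>e\<in>E. alg_supp_le H k e)"
    using k map_eq_one closed by metis
qed

text \<open>A centered family above the image pulls back along \<open>\<psi>'\<close> to a centered
  family above \<open>F\<close>, which must be \<open>F\<close> itself.\<close>

lemma map_max_centered:
  assumes F: "max_centered G F"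
  shows "max_centered H (\<psi> ` F)"
  unfolding max_centered_def
proof (intro conjI allI impI)
  show "centered H (\<psi> ` F)" using map_centered_imp[OF max_centeredD(1)[OF F]] .
  fix E assume E: "centered H E \<and> \<psi> ` F \<subseteq> E"
  have F_sub: "F \<subseteq> carrier G" using centered_subset[OF max_centeredD(1)[OF F]] .
  have E_sub: "E \<subseteq> carrier H" using centered_subset E by blast
  have "centered G (\<psi>' ` E)"
    using group_iso_pair.map_centered_imp[OF flip] E by blast
  moreover have "F \<subseteq> \<psi>' ` E"
  proof
    fix f assume f: "f \<in> F"
    then have "\<psi>' (\<psi> f) \<in> \<psi>' ` E" using E by blast
    moreover have "\<psi>' (\<psi> f) = f" using inverse(1) f F_sub by blast
    ultimately show "f \<in> \<psi>' ` E" by simp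
  qed
  ultimately have eq: "\<psi>' ` E = F" by (rule max_centeredD(2)[OF F])
  have "\<psi> ` \<psi>' ` E = id ` E"
    unfolding image_image using inverse(2) E_sub by (intro image_cong) auto
  then show "E = \<psi> ` F" using eq by simp
qed

end

subsection \<open>Recovering the space from the group\<close>

text \<open>\<open>open_support\<close> makes closed supports clopen. \<open>swap\<close> provides
  elements of arbitrarily small support and excludes isolated points, because \<open>s\<close>
  cannot move \<open>x\<close> while fixing everything else. That \<open>s\<close> is an involution
  is what gives control over the orders of elements.\<close>

locale clopen_swap_action = faithful_action G "topspace X" \<phi>
  for G (structure) and X :: "'b topology" and \<phi> +
  assumes continuous: "g \<in> carrier G \<Longrightarrow> continuous_map X X (\<phi> g)"
    and compact: "compact_space X" and Hausdorff: "Hausdorff_space X"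
    and open_support: "g \<in> carrier G \<Longrightarrow> openin X (X closure_of {x \<in> topspace X. \<phi> g x \<noteq> x})"
    and swap: "\<lbrakk>openin X U; x \<in> U\<rbrakk> \<Longrightarrow>
      \<exists>s\<in>carrier G. s \<otimes> s = \<one> \<and> \<phi> s x \<noteq> x \<and> {y \<in> topspace X. \<phi> s y \<noteq> y} \<subseteq> U"

section \<open>Moved sets and closed supports\<close>

sublocale clopen_swap_action \<subseteq> group G
  using group_hom group_hom.axioms(1) by blast

context clopen_swap_action
begin

definition moved :: "'a \<Rightarrow> 'b set" where
  "moved g = {x \<in> topspace X. \<phi> g x \<noteq> x}"

definition supp :: "'a \<Rightarrow> 'b set" where
  "supp g = X closure_of moved g"

lemma moved_subset: "moved g \<subseteq> topspace X"
  by (auto simp: moved_def)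

lemma act_fixed: "\<lbrakk>x \<in> topspace X; x \<notin> moved g\<rbrakk> \<Longrightarrow> \<phi> g x = x"
  by (auto simp: moved_def)

lemma supp_subset: "supp g \<subseteq> topspace X"
  by (simp add: supp_def closure_of_subset_topspace)

lemma moved_subset_supp: "moved g \<subseteq> supp g"
  by (simp add: supp_def closure_of_subset moved_subset)

lemma act_mult:
  "\<lbrakk>g \<in> carrier G; h \<in> carrier G; x \<in> topspace X\<rbrakk> \<Longrightarrow> \<phi> (g \<otimes> h) x = \<phi> g (\<phi> h x)"
  by (rule composition_rule)

lemma act_closed: "\<lbrakk>g \<in> carrier G; x \<in> topspace X\<rbrakk> \<Longrightarrow> \<phi> g x \<in> topspace X"
  by (rule element_image) auto

lemma act_one: "x \<in> topspace X \<Longrightarrow> \<phi> \<one> x = x"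
  by (metis id_eq_one restrict_apply')

lemma act_inv_left: "\<lbrakk>g \<in> carrier G; x \<in> topspace X\<rbrakk> \<Longrightarrow> \<phi> (inv g) (\<phi> g x) = x"
  by (metis act_mult act_one inv_closed l_inv)

lemma act_inv_right: "\<lbrakk>g \<in> carrier G; x \<in> topspace X\<rbrakk> \<Longrightarrow> \<phi> g (\<phi> (inv g) x) = x"
  by (metis act_mult act_one inv_closed r_inv)

lemma act_inj: "\<lbrakk>g \<in> carrier G; x \<in> topspace X; y \<in> topspace X\<rbrakk> \<Longrightarrow> \<phi> g x = \<phi> g y \<longleftrightarrow> x = y"
  using act_inv_left by metis

lemma act_pow: "\<lbrakk>g \<in> carrier G; x \<in> topspace X\<rbrakk> \<Longrightarrow> \<phi> (g [^] (n::nat)) x = (\<phi> g ^^ n) x"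
proof (induction n arbitrary: x)
  case (Suc n)
  then show ?case by (simp add: act_mult act_closed funpow_swap1 del: funpow.simps)
      (simp add: funpow_swap1)
qed (simp add: act_one)

lemma act_eqI:
  assumes "g \<in> carrier G" "h \<in> carrier G" "\<And>x. x \<in> topspace X \<Longrightarrow> \<phi> g x = \<phi> h x"
  shows "g = h"
proof (rule inj_onD[OF faithful])
  show "\<phi> g = \<phi> h"
    using bij_prop0[OF assms(1)] bij_prop0[OF assms(2)] assms(3)
    by (auto simp: Bij_def intro: extensionalityI)
qed (use assms in auto)

lemma moved_eq_empty_iff: "g \<in> carrier G \<Longrightarrow> moved g = {} \<longleftrightarrow> g = \<one>"
  using act_eqI[of g \<one>] act_one by (auto simp: moved_def)

lemma supp_eq_empty_iff: "g \<in> carrier G \<Longrightarrow> supp g = {} \<longleftrightarrow> g = \<one>"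
  by (metis closure_of_eq_empty_gen supp_def moved_eq_empty_iff moved_subset disjnt_def inf.absorb_iff2 inf_commute)

lemma moved_invariant: "\<lbrakk>g \<in> carrier G; x \<in> moved g\<rbrakk> \<Longrightarrow> \<phi> g x \<in> moved g"
  by (auto simp: moved_def act_closed act_inj)

text \<open>Each element maps its moved set into itself, so where one of the two acts, the other is
  trivial both before and after.\<close>

lemma commuting_if_disjoint:
  assumes fg: "f \<in> carrier G" "g \<in> carrier G" and disj: "moved f \<inter> moved g = {}"
  shows "commuting G f g"
  unfolding commuting_def
proof (rule act_eqI)
  fix x assume x: "x \<in> topspace X"
  show "\<phi> (f \<otimes> g) x = \<phi> (g \<otimes> f) x"
  proof (cases "x \<in> moved f")
    case True
    then have "\<phi> f x \<in> moved f" using fg moved_invariant by auto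
    then have "\<phi> g x = x" "\<phi> g (\<phi> f x) = \<phi> f x"
      using True disj x fg act_closed unfolding moved_def by blast+
    then show ?thesis using x fg by (simp add: act_mult)
  next
    case False
    then have "\<phi> f x = x" using x by (simp add: act_fixed)
    moreover have "\<phi> f (\<phi> g x) = \<phi> g x"
    proof (cases "x \<in> moved g")
      case True
      then have "\<phi> g x \<notin> moved f" using moved_invariant[of g x] fg disj by blast
      then show ?thesis using x fg by (simp add: act_fixed act_closed)
    next
      case False
      then show ?thesis using x \<open>\<phi> f x = x\<close> by (simp add: act_fixed)
    qed
    ultimately show ?thesis using x fg by (simp add: act_mult)
  qed
qed (use fg in auto)

section \<open>Displaced neighbourhoods and elements of small support\<close>

lemma openin_moved:
  assumes g: "g \<in> carrier G" shows "openin X (moved g)"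
proof -
  have "closedin X {x \<in> topspace X. \<phi> g x = id x}"
    by (rule closedin_continuous_maps_eq[OF Hausdorff continuous[OF g] continuous_map_id])
  moreover have "moved g = topspace X - {x \<in> topspace X. \<phi> g x = id x}"
    by (auto simp: moved_def)
  ultimately show ?thesis by auto
qed

text \<open>Separating \<open>x\<close> from each \<open>\<phi> g x\<close> and intersecting the
  finitely many neighbourhoods suffices. A finite set is allowed because \<open>f\<close> and four
  powers of \<open>g\<close> must later displace the same neighbourhood.\<close>

lemma displaced_nbhd:
  assumes "finite E" "E \<subseteq> carrier G" "openin X V" "x \<in> V" "\<And>g. g \<in> E \<Longrightarrow> \<phi> g x \<noteq> x"
  shows "\<exists>U. openin X U \<and> x \<in> U \<and> U \<subseteq> V \<and> (\<forall>g\<in>E. \<phi> g ` U \<inter> U = {})"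
  using assms
proof (induction E)
  case empty
  then show ?case by blast
next
  case (insert g E)
  then obtain U where U: "openin X U" "x \<in> U" "U \<subseteq> V" "\<forall>g\<in>E. \<phi> g ` U \<inter> U = {}"
    by auto
  have x: "x \<in> topspace X" using U openin_subset by blast
  have g: "g \<in> carrier G" "\<phi> g x \<noteq> x" using insert by auto
  obtain P Q where PQ: "openin X P" "openin X Q" "x \<in> P" "\<phi> g x \<in> Q" "disjnt P Q"
    using Hausdorff x g act_closed unfolding Hausdorff_space_def by metis
  define W where "W = U \<inter> P \<inter> {y \<in> topspace X. \<phi> g y \<in> Q}"
  have "openin X W"
    unfolding W_def using PQ U openin_continuous_map_preimage[OF continuous[OF g(1)] PQ(2)] by blast
  moreover have "x \<in> W" "W \<subseteq> V" using x U PQ by (auto simp: W_def)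
  moreover have "\<phi> g ` W \<inter> W = {}" using PQ(5) by (auto simp: W_def disjnt_def)
  moreover have "\<forall>h\<in>E. \<phi> h ` W \<inter> W = {}" using U(4) by (fastforce simp: W_def)
  ultimately show ?case by (metis insert_iff)
qed

lemma displaced_nbhd1:
  assumes "g \<in> carrier G" "openin X V" "x \<in> V" "\<phi> g x \<noteq> x"
  obtains U where "openin X U" "x \<in> U" "U \<subseteq> V" "\<phi> g ` U \<inter> U = {}"
  using displaced_nbhd[of "{g}" V x] assms by auto

lemma moved_mult:
  assumes "a \<in> carrier G" "b \<in> carrier G"
  shows "moved (a \<otimes> b) \<subseteq> moved a \<union> moved b"
  using assms by (auto simp: moved_def act_mult)

lemma moved_inv: "a \<in> carrier G \<Longrightarrow> moved (inv a) = moved a"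
  unfolding moved_def using act_inv_left act_inv_right by (metis (lifting))

lemma moved_conj:
  assumes "a \<in> carrier G" "b \<in> carrier G"
  shows "x \<in> moved (a \<otimes> b \<otimes> inv a) \<longleftrightarrow> x \<in> topspace X \<and> \<phi> (inv a) x \<in> moved b"
proof -
  have "\<phi> (a \<otimes> b \<otimes> inv a) x = \<phi> a (\<phi> b (\<phi> (inv a) x))" if "x \<in> topspace X"
    using that assms by (simp add: act_mult act_closed)
  moreover have "\<phi> a (\<phi> b (\<phi> (inv a) x)) = x \<longleftrightarrow> \<phi> b (\<phi> (inv a) x) = \<phi> (inv a) x" if "x \<in> topspace X"
    using that assms by (metis act_closed act_inv_left act_inv_right inv_closed)
  ultimately show ?thesis using assms act_closed by (auto simp: moved_def)
qed

text \<open>The commutator is the conjugate of \<open>b\<close> by \<open>a\<close> times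
  \<open>inv b\<close>, so it moves only points of \<open>moved b\<close> and of its translate by
  \<open>a\<close>.\<close>

lemma moved_commutator:
  assumes "a \<in> carrier G" "b \<in> carrier G" "x \<in> moved (commutator G a b)"
  shows "x \<in> moved b \<or> \<phi> (inv a) x \<in> moved b"
  using moved_mult[of "a \<otimes> b \<otimes> inv a" "inv b"] moved_conj[of a b x] assms
  by (auto simp: commutator_def moved_inv)

lemma commutator_closed: "\<lbrakk>a \<in> carrier G; b \<in> carrier G\<rbrakk> \<Longrightarrow> commutator G a b \<in> carrier G"
  by (simp add: commutator_def)

text \<open>If the involution \<open>s\<close> moves \<open>V\<close> off itself and \<open>g\<close> is supported in \<open>V\<close>, then \<open>(s g)\<^sup>2\<close> acts on
  \<open>V\<close> as \<open>g\<close>.\<close>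

lemma double_order:
  assumes step: "\<And>U. \<lbrakk>openin X U; U \<noteq> {}\<rbrakk> \<Longrightarrow> \<exists>g\<in>carrier G. moved g \<subseteq> U \<and> g [^] m \<noteq> \<one>"
    and U: "openin X U" "U \<noteq> {}"
  shows "\<exists>g\<in>carrier G. moved g \<subseteq> U \<and> g [^] (2 * m :: nat) \<noteq> \<one>"
proof -
  obtain x where x: "x \<in> U" using U by blast
  then obtain s where s: "s \<in> carrier G" "s \<otimes> s = \<one>" "\<phi> s x \<noteq> x" "moved s \<subseteq> U"
    using swap[OF U(1), of x] unfolding moved_def by blast
  obtain V where V: "openin X V" "x \<in> V" "V \<subseteq> U" "\<phi> s ` V \<inter> V = {}"
    using displaced_nbhd1[OF s(1) U(1) x s(3)] .
  obtain g where g: "g \<in> carrier G" "moved g \<subseteq> V" "g [^] m \<noteq> \<one>"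
    using step[OF V(1)] V(2) by blast
  obtain y where y: "y \<in> topspace X" "\<phi> (g [^] m) y \<noteq> y"
    using g moved_eq_empty_iff[of "g [^] m"] by (auto simp: moved_def)
  have gV: "\<phi> g z \<in> V" if "z \<in> V" for z
    using that g V(1) moved_invariant[OF g(1), of z] openin_subset[OF V(1)]
    by (cases "z \<in> moved g") (auto simp: moved_def)
  have yV: "y \<in> V"
  proof (rule ccontr)
    assume "y \<notin> V"
    then have "\<phi> g y = y" using g y by (auto simp: moved_def)
    then have "(\<phi> g ^^ m) y = y" by (induction m) auto
    then show False using y act_pow g by auto
  qed
  have sq: "\<phi> ((s \<otimes> g) [^] (2::nat)) z = \<phi> g z" if z: "z \<in> V" for z
  proof -
    have zX: "z \<in> topspace X" using z openin_subset[OF V(1)] by blast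
    have "\<phi> s (\<phi> g z) \<notin> V" using gV z V(4) by blast
    then have fixed: "\<phi> g (\<phi> s (\<phi> g z)) = \<phi> s (\<phi> g z)"
      using g s zX by (intro act_fixed act_closed) auto
    have "\<phi> ((s \<otimes> g) [^] (2::nat)) z = \<phi> s (\<phi> g (\<phi> s (\<phi> g z)))"
      using zX g s by (simp add: numeral_2_eq_2 act_mult act_closed)
    also have "\<dots> = \<phi> (s \<otimes> s) (\<phi> g z)" using fixed zX g s(1) by (simp add: act_mult act_closed)
    finally show ?thesis using s(2) zX g by (simp add: act_one act_closed)
  qed
  have "(\<phi> ((s \<otimes> g) [^] (2::nat)) ^^ n) y = (\<phi> g ^^ n) y \<and> (\<phi> g ^^ n) y \<in> V" for n
    by (induction n) (auto simp: sq gV yV)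
  then have "\<phi> ((s \<otimes> g) [^] (2 * m)) y = \<phi> (g [^] m) y"
    using y g s by (simp add: act_pow flip: nat_pow_pow)
  then have "(s \<otimes> g) [^] (2 * m) \<noteq> \<one>" using y act_one by auto
  moreover have "moved (s \<otimes> g) \<subseteq> U" using moved_mult[of s g] g s V by blast
  ultimately show ?thesis using g s by blast
qed

text \<open>A nontrivial involution equals its own cube, which gives exponent 3; doubling twice
  leads to 6 and 12.\<close>

lemma ex_pow12_nontrivial:
  assumes "openin X U" "U \<noteq> {}"
  shows "\<exists>g\<in>carrier G. moved g \<subseteq> U \<and> g [^] (12::nat) \<noteq> \<one>"
proof -
  have 3: "\<exists>g\<in>carrier G. moved g \<subseteq> V \<and> g [^] (3::nat) \<noteq> \<one>" if V: "openin X V" "V \<noteq> {}" for V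
  proof -
    obtain x where x: "x \<in> V" using V by blast
    then obtain s where s: "s \<in> carrier G" "s \<otimes> s = \<one>" "\<phi> s x \<noteq> x" "moved s \<subseteq> V"
      using swap[OF V(1), of x] unfolding moved_def by blast
    have "s \<noteq> \<one>" using s(3) act_one x openin_subset[OF V(1)] by auto
    then show ?thesis using s by (auto simp: numeral_3_eq_3 intro!: bexI[of _ s])
  qed
  have 6: "\<exists>g\<in>carrier G. moved g \<subseteq> V \<and> g [^] (6::nat) \<noteq> \<one>" if "openin X V" "V \<noteq> {}" for V
    using double_order[OF 3 that] by simp
  show ?thesis using double_order[OF 6 assms] by simp
qed

lemma ex_nontrivial:
  assumes "openin X U" "U \<noteq> {}"
  shows "\<exists>g\<in>carrier G. moved g \<subseteq> U \<and> g \<noteq> \<one>"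
  using ex_pow12_nontrivial[OF assms] nat_pow_one by metis

section \<open>Comparing supports by commutation\<close>

lemma not_commuting_if_displaced:
  assumes fg: "f \<in> carrier G" "g \<in> carrier G" and U: "U \<subseteq> topspace X"
    and "moved g \<subseteq> U" "g \<noteq> \<one>" "\<phi> f ` U \<inter> U = {}"
  shows "\<not> commuting G f g"
proof
  assume "commuting G f g"
  have "moved g \<noteq> {}" using assms moved_eq_empty_iff by simp
  then obtain x where x: "x \<in> moved g" by blast
  then have xX: "x \<in> topspace X" "x \<in> U" using assms by auto
  \<comment> \<open>The image of \<open>x\<close> has left \<open>U\<close>, whereas an
    \<open>f\<close> commuting with \<open>g\<close> would map \<open>moved g\<close> into
    itself.\<close>
  have "\<phi> f x \<notin> moved g" using assms x by blast
  then have "\<phi> g (\<phi> f x) = \<phi> f x" using fg xX act_closed by (auto simp: moved_def)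
  moreover have "\<phi> f (\<phi> g x) = \<phi> g (\<phi> f x)"
    using \<open>commuting G f g\<close> fg xX unfolding commuting_def by (metis act_mult)
  ultimately show False using x fg act_inj[of f "\<phi> g x" x] act_closed by (auto simp: moved_def)
qed

text \<open>Choose \<open>U\<close> inside \<open>moved f\<close> displaced by \<open>h\<close>,
  then \<open>b\<close> supported in \<open>U\<close>, then \<open>V\<close> inside
  \<open>moved b\<close> displaced by \<open>b\<close>, and finally \<open>a\<close> supported in
  \<open>V\<close>. The double commutator is nontrivial because \<open>[b, h]\<close> still
  displaces \<open>V\<close>, and it stays supported in \<open>U\<close>, away from
  \<open>g\<close>.\<close>

lemma alg_disjoint_if_disjoint:
  assumes fg: "f \<in> carrier G" "g \<in> carrier G" and disj: "moved f \<inter> moved g = {}"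
  shows "alg_disjoint G g f"
  unfolding alg_disjoint_def
proof (intro ballI impI)
  fix h assume h: "h \<in> carrier G" and "\<not> commuting G f h"
  then obtain x where x: "x \<in> moved f" "x \<in> moved h"
    using commuting_if_disjoint fg by blast
  obtain U where U: "openin X U" "x \<in> U" "U \<subseteq> moved f" "\<phi> h ` U \<inter> U = {}"
    using displaced_nbhd1[OF h openin_moved[OF fg(1)] x(1)] x(2) by (auto simp: moved_def)
  obtain b where b: "b \<in> carrier G" "moved b \<subseteq> U" "b \<noteq> \<one>"
    using ex_nontrivial[OF U(1)] U(2) by blast
  then obtain y where y: "y \<in> moved b" using moved_eq_empty_iff by auto
  obtain V where V: "openin X V" "y \<in> V" "V \<subseteq> moved b" "\<phi> b ` V \<inter> V = {}"
    using displaced_nbhd1[OF b(1) openin_moved[OF b(1)] y] y by (auto simp: moved_def)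
  obtain a where a: "a \<in> carrier G" "moved a \<subseteq> V" "a \<noteq> \<one>"
    using ex_nontrivial[OF V(1)] V(2) by blast
  have ab: "commuting G a g" "commuting G b g"
    using a b V U disj fg by (intro commuting_if_disjoint; blast)+
  define k where "k = commutator G b h"
  have k: "k \<in> carrier G" using commutator_closed b h by (simp add: k_def)
  have UX: "U \<subseteq> topspace X" "V \<subseteq> U" using U moved_subset b V by blast+
  \<comment> \<open>On \<open>V\<close> the element \<open>k\<close> acts as \<open>b\<close>:
    \<open>inv h\<close> first carries the point out of \<open>U\<close>, where \<open>inv b\<close>
    is trivial, and \<open>h\<close> brings it back.\<close>
  have kV: "\<phi> k ` V \<inter> V = {}"
  proof -
    have "\<phi> k z = \<phi> b z" if z: "z \<in> V" for z
    proof -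
      have zX: "z \<in> topspace X" "z \<in> U" using z UX by auto
      have "\<phi> (inv h) z \<notin> U" using zX U(4) h act_inv_right by (metis IntI empty_iff image_eqI)
      then have "\<phi> (inv b) (\<phi> (inv h) z) = \<phi> (inv h) z"
        using b h zX act_closed moved_inv[OF b(1)] by (auto simp: moved_def)
      then show ?thesis
        using b h zX by (simp add: k_def commutator_def act_mult act_closed act_inv_right)
    qed
    then show ?thesis using V(4) by (metis (no_types, lifting) image_cong)
  qed
  have ne: "commutator G a k \<noteq> \<one>"
  proof
    assume "commutator G a k = \<one>"
    then have "a \<otimes> k \<otimes> inv a \<otimes> inv k \<otimes> k \<otimes> a = k \<otimes> a"
      using a k by (simp add: commutator_def m_assoc)
    then have "commuting G k a"
      using a k by (simp add: commuting_def m_assoc)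
    then show False using not_commuting_if_displaced[OF k a(1) _ a(2,3) kV] UX by blast
  qed
  have "moved (commutator G a k) \<subseteq> U"
  proof
    fix z assume z: "z \<in> moved (commutator G a k)"
    \<comment> \<open>In this bracketing the commutator can move only points of
      \<open>moved a\<close> and of its translate by \<open>k\<close>.\<close>
    have "commutator G a k = a \<otimes> (k \<otimes> inv a \<otimes> inv k)"
      using a k by (simp add: commutator_def m_assoc)
    then have "z \<in> moved a \<or> \<phi> (inv k) z \<in> moved a"
      using z moved_mult[of a "k \<otimes> inv a \<otimes> inv k"] moved_conj[of k "inv a" z] a k
      by (auto simp: moved_inv)
    moreover have "z \<in> U" if "\<phi> (inv k) z \<in> moved a"
    proof -
      have zX: "z \<in> topspace X" using z moved_subset by blast
      have "\<phi> (inv k) z \<in> V" using that a by blast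
      show ?thesis
      proof (rule ccontr)
        \<comment> \<open>Outside \<open>U\<close> the factor \<open>inv b\<close> of
          \<open>inv k\<close> is trivial, so \<open>inv k\<close> sends \<open>z\<close> either to
          \<open>z\<close> itself or into the translate of \<open>U\<close> by \<open>h\<close>.
          Both lie outside \<open>U\<close> and hence outside \<open>V\<close>.\<close>
        assume zU: "z \<notin> U"
        have "\<phi> (inv b) z = z" using zU zX b moved_inv[OF b(1)] by (auto simp: moved_def)
        moreover have "inv k = h \<otimes> b \<otimes> inv h \<otimes> inv b"
          using b h by (simp add: k_def commutator_def inv_mult_group m_assoc)
        ultimately have eq: "\<phi> (inv k) z = \<phi> h (\<phi> b (\<phi> (inv h) z))"
          using b h zX by (simp add: act_mult act_closed)
        have "\<phi> (inv h) z \<in> topspace X" using h zX act_closed by auto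
        show False
        proof (cases "\<phi> (inv h) z \<in> moved b")
          case True
          then have "\<phi> b (\<phi> (inv h) z) \<in> U" using b moved_invariant by blast
          then show False using eq U(4) \<open>\<phi> (inv k) z \<in> V\<close> UX by auto
        next
          case False
          then have "\<phi> (inv k) z = z"
            using eq h zX act_closed by (auto simp: moved_def act_inv_right)
          then show False using zU \<open>\<phi> (inv k) z \<in> V\<close> UX by auto
        qed
      qed
    qed
    ultimately show "z \<in> U" using a UX by blast
  qed
  then have "commuting G (commutator G a k) g"
    using a k fg U(3) disj commutator_closed by (intro commuting_if_disjoint; blast)
  then show "\<exists>a\<in>carrier G. \<exists>b\<in>carrier G. commuting G a g \<and> commuting G b g \<and>
           commutator G a (commutator G b h) \<noteq> \<one> \<and>
           commuting G (commutator G a (commutator G b h)) g"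
    using a b ab ne unfolding k_def by blast
qed

lemma commuting_act:
  assumes "a \<in> carrier G" "b \<in> carrier G" "commuting G a b" "x \<in> topspace X"
  shows "\<phi> a (\<phi> b x) = \<phi> b (\<phi> a x)"
  using assms unfolding commuting_def by (metis act_mult)

lemma commuting_inv:
  assumes "a \<in> carrier G" "b \<in> carrier G" "commuting G a b"
  shows "commuting G (inv a) b"
proof -
  have "inv a \<otimes> b = inv a \<otimes> (b \<otimes> a) \<otimes> inv a" using assms by (simp add: m_assoc)
  also have "\<dots> = inv a \<otimes> (a \<otimes> b) \<otimes> inv a" using assms(3) by (simp add: commuting_def)
  also have "\<dots> = b \<otimes> inv a" using assms by (simp flip: m_assoc)
  finally show ?thesis by (simp add: commuting_def)
qed

lemma commuting_mult:
  assumes "a \<in> carrier G" "b \<in> carrier G" "g \<in> carrier G" "commuting G a g" "commuting G b g"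
  shows "commuting G (a \<otimes> b) g"
proof -
  have "a \<otimes> b \<otimes> g = a \<otimes> (g \<otimes> b)" using assms by (simp add: m_assoc commuting_def)
  also have "\<dots> = a \<otimes> g \<otimes> b" using assms by (simp add: m_assoc)
  also have "\<dots> = g \<otimes> a \<otimes> b" using assms by (simp add: commuting_def)
  finally show ?thesis using assms by (simp add: commuting_def m_assoc)
qed

lemma commuting_sym: "commuting G a b \<longleftrightarrow> commuting G b a"
  by (auto simp: commuting_def)

lemma commuting_pow:
  assumes "a \<in> carrier G" "b \<in> carrier G" "commuting G a b"
  shows "commuting G a (b [^] (n::nat))"
proof (induction n)
  case (Suc n)
  then show ?case
    using assms commuting_mult[of "b [^] n" b a] by (simp add: commuting_sym[of a])
qed (use assms in \<open>simp add: commuting_def\<close>)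

text \<open>With \<open>h\<close> supported in a set \<open>U\<close> whose translates \<open>U, g U, \<dots>, g\<^sup>4 U\<close> are disjoint, \<open>[a, [b, h]]\<close>
  is supported in the four sets \<open>U, a U, b U, a b U\<close>. Its support is invariant under \<open>g\<close>, so two of
  the five points \<open>y, g y, \<dots>, g\<^sup>4 y\<close> of a nontrivial orbit lie in the same one of these sets.\<close>

lemma disjoint_if_alg_disjoint:
  assumes fg: "f \<in> carrier G" "g \<in> carrier G" and disj: "alg_disjoint G g f"
  shows "moved f \<inter> moved (g [^] (12::nat)) = {}"
proof (rule ccontr)
  assume "\<not> ?thesis"
  then obtain x where x: "x \<in> moved f" "x \<in> moved (g [^] (12::nat))" by blast
  have xX: "x \<in> topspace X" using x moved_subset by blast
  have free: "\<phi> (g [^] d) x \<noteq> x" if "d \<in> {1..4}" for d :: nat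
  proof
    assume eq: "\<phi> (g [^] d) x = x"
    have "d = 1 \<or> d = 2 \<or> d = 3 \<or> d = 4" using that by auto
    then have "d dvd 12" by auto
    then obtain e where e: "12 = d * e" by (rule dvdE)
    have "(\<phi> (g [^] d) ^^ e) x = x" using eq by (induction e) auto
    then have "\<phi> (g [^] (12::nat)) x = x" using fg xX by (simp add: e act_pow flip: nat_pow_pow)
    then show False using x by (simp add: moved_def)
  qed
  obtain U where U: "openin X U" "x \<in> U" "U \<subseteq> moved f"
    and Ud: "\<forall>g\<in>insert f ((\<lambda>d. g [^] d) ` {1..4::nat}). \<phi> g ` U \<inter> U = {}"
    using displaced_nbhd[of "insert f ((\<lambda>d. g [^] d) ` {1..4::nat})" "moved f" x] fg x free openin_moved
    by (force simp: moved_def)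
  obtain h where h: "h \<in> carrier G" "moved h \<subseteq> U" "h \<noteq> \<one>"
    using ex_nontrivial[OF U(1)] U(2) by blast
  have "\<not> commuting G f h"
    using not_commuting_if_displaced[OF fg(1) h(1) _ h(2,3)] Ud openin_subset[OF U(1)] by blast
  then obtain a b where ab: "a \<in> carrier G" "b \<in> carrier G" "commuting G a g" "commuting G b g"
     and ne: "commutator G a (commutator G b h) \<noteq> \<one>"
     and com: "commuting G (commutator G a (commutator G b h)) g"
    using disj h unfolding alg_disjoint_def by blast
  define k where "k = commutator G a (commutator G b h)"
  have k: "k \<in> carrier G" using ab h by (simp add: k_def commutator_closed)
  \<comment> \<open>These are the inverses of \<open>\<one>\<close>, \<open>a\<close>,
    \<open>b\<close> and \<open>a \<otimes> b\<close>: a point lies in one of the four translates of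
    \<open>U\<close> when some \<open>w\<close> in \<open>W\<close> sends it into
    \<open>U\<close>.\<close>
  define W where "W = {\<one>, inv a, inv b, inv b \<otimes> inv a}"
  have WG: "w \<in> carrier G" if "w \<in> W" for w using that ab by (auto simp: W_def)
  have cover: "\<exists>w\<in>W. \<phi> w z \<in> U" if z: "z \<in> moved k" for z
  proof -
    have zX: "z \<in> topspace X" using z moved_subset by blast
    have "z \<in> moved (commutator G b h) \<or> \<phi> (inv a) z \<in> moved (commutator G b h)"
      using z ab h unfolding k_def by (intro moved_commutator) (auto simp: commutator_closed)
    then have "z \<in> moved h \<or> \<phi> (inv b) z \<in> moved h \<or> \<phi> (inv a) z \<in> moved h
        \<or> \<phi> (inv b) (\<phi> (inv a) z) \<in> moved h"
      using moved_commutator ab h by blast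
    then show ?thesis
      using h zX ab unfolding W_def by (auto simp: act_one act_mult)
  qed
  have Wg: "commuting G w g" if "w \<in> W" for w
  proof -
    have 1: "commuting G (inv a) g" "commuting G (inv b) g" using ab fg commuting_inv by auto
    moreover have "commuting G (inv b \<otimes> inv a) g"
      using 1 ab fg commuting_mult by simp
    ultimately show ?thesis using that fg by (auto simp: W_def commuting_def)
  qed
  obtain y where y: "y \<in> moved k" using ne k moved_eq_empty_iff unfolding k_def by blast
  have yX: "y \<in> topspace X" using y moved_subset by blast
  \<comment> \<open>Since \<open>k\<close> commutes with the powers of \<open>g\<close>, they
    preserve its moved set.\<close>
  have ym: "\<phi> (g [^] i) y \<in> moved k" for i :: nat
    using y yX k fg commuting_act[OF k _ commuting_pow[OF k fg(2)] yX, of i]  com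
      act_inj[of "g [^] i" "\<phi> k y" y]
    by (auto simp: moved_def act_closed k_def)
  define v where "v i = (SOME w. w \<in> W \<and> \<phi> w (\<phi> (g [^] (i::nat)) y) \<in> U)" for i
  have v: "v i \<in> W" "\<phi> (v i) (\<phi> (g [^] i) y) \<in> U" for i
    using someI_ex[of "\<lambda>w. w \<in> W \<and> \<phi> w (\<phi> (g [^] (i::nat)) y) \<in> U"] cover[OF ym[of i]]
    by (auto simp: v_def)
  \<comment> \<open>Pigeonhole: five indices, at most four values of \<open>v\<close>.\<close>
  have "card W \<le> 4" "finite W" unfolding W_def by (auto intro!: card_insert_le_m1)
  moreover have "v ` {0..4} \<subseteq> W" using v by auto
  ultimately have "\<not> inj_on v {0..4}"
    using card_inj_on_le[of v "{0..4}" W] by auto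
  then obtain i j where ij: "i < j" "j \<le> 4" "v i = v j"
    unfolding inj_on_def by (metis atLeastAtMost_iff nat_neq_iff)
  \<comment> \<open>As \<open>v i\<close> commutes with \<open>g\<close>, the power
    \<open>?d\<close> takes the point \<open>?z\<close> of \<open>U\<close> to the point obtained
    from index \<open>j\<close>, again in \<open>U\<close>, although \<open>?d\<close> displaces
    \<open>U\<close>.\<close>
  let ?z = "\<phi> (v i) (\<phi> (g [^] i) y)" and ?d = "g [^] (j - i)"
  have "g [^] j = ?d \<otimes> g [^] i" using ij fg by (simp add: nat_pow_mult)
  then have "\<phi> (v i) (\<phi> (g [^] j) y) = \<phi> (v i) (\<phi> ?d (\<phi> (g [^] i) y))"
    using fg yX by (simp add: act_mult)
  also have "\<dots> = \<phi> ?d ?z"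
    using fg v(1) yX WG Wg by (intro commuting_act commuting_pow) (auto simp: act_closed)
  finally have "\<phi> ?d ?z \<in> U" using v(2)[of j] ij by simp
  moreover have "?z \<in> U" using v(2) .
  moreover have "j - i \<in> {1..4}" using ij by auto
  ultimately show False using Ud by blast
qed

text \<open>If supports are included, the open set moved by \<open>g [^] 12\<close> misses
  \<open>moved f'\<close>, hence its closure, hence \<open>moved f\<close>. If \<open>f\<close>
  moves a point outside \<open>supp f'\<close>, an element \<open>g\<close> with
  \<open>g [^] 12\<close> nontrivial, living on a small displaced neighbourhood there, violates the
  algebraic relation.\<close>

lemma alg_supp_le_iff:
  assumes f: "f \<in> carrier G" "f' \<in> carrier G"
  shows "alg_supp_le G f f' \<longleftrightarrow> supp f \<subseteq> supp f'"
proof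
  assume sub: "supp f \<subseteq> supp f'"
  show "alg_supp_le G f f'"
    unfolding alg_supp_le_def
  proof (intro ballI impI)
    fix g assume g: "g \<in> carrier G" "alg_disjoint G g f'"
    have "moved f' \<inter> moved (g [^] (12::nat)) = {}" using disjoint_if_alg_disjoint f g by blast
    then have "moved (g [^] (12::nat)) \<inter> supp f' = {}"
      using g openin_moved[of "g [^] (12::nat)"] openin_Int_closure_of_eq_empty unfolding supp_def
      by (metis inf_commute nat_pow_closed)
    then have "moved f \<inter> moved (g [^] (12::nat)) = {}" using sub moved_subset_supp by blast
    then show "commuting G f (g [^] (12::nat))" using f g by (simp add: commuting_if_disjoint)
  qed
next
  assume le: "alg_supp_le G f f'"
  have "moved f \<subseteq> supp f'"
  proof (rule ccontr)
    assume "\<not> ?thesis"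
    then obtain x where x: "x \<in> moved f" "x \<notin> supp f'" by blast
    have "openin X (topspace X - supp f')" unfolding supp_def by (simp add: openin_diff)
    moreover have "x \<in> topspace X - supp f'" "\<phi> f x \<noteq> x" using x by (auto simp: moved_def)
    ultimately obtain U where U: "openin X U" "x \<in> U" "U \<subseteq> topspace X - supp f'" "\<phi> f ` U \<inter> U = {}"
      using displaced_nbhd1[OF f(1)] by blast
    obtain g where g: "g \<in> carrier G" "moved g \<subseteq> U" "g [^] (12::nat) \<noteq> \<one>"
      using ex_pow12_nontrivial[OF U(1)] U(2) by blast
    have "moved f' \<inter> moved g = {}" using g U moved_subset_supp by blast
    then have "commuting G f (g [^] (12::nat))"
      using le g f alg_disjoint_if_disjoint unfolding alg_supp_le_def by blast
    moreover have "moved (g [^] (12::nat)) \<subseteq> moved g"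
    proof
      fix z assume z: "z \<in> moved (g [^] (12::nat))"
      then have zX: "z \<in> topspace X" using moved_subset by blast
      show "z \<in> moved g"
      proof (rule ccontr)
        assume "z \<notin> moved g"
        then have "\<phi> g z = z" using zX by (simp add: moved_def)
        then have "(\<phi> g ^^ n) z = z" for n by (induction n) auto
        then show False using z zX g by (auto simp: moved_def act_pow)
      qed
    qed
    ultimately show False
      using not_commuting_if_displaced[of f "g [^] (12::nat)" U] f g U by auto
  qed
  then show "supp f \<subseteq> supp f'"
    unfolding supp_def using closure_of_minimal by (metis closedin_closure_of)
qed

section \<open>Points as maximal centered families\<close>

definition point_family :: "'b \<Rightarrow> 'a set" where
  "point_family x = {f \<in> carrier G. x \<in> supp f}"

lemma clopen_supp: "g \<in> carrier G \<Longrightarrow> openin X (supp g)" "closedin X (supp g)"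
  using open_support by (auto simp: supp_def moved_def)

text \<open>Regularity puts a closed set between a smaller neighbourhood and \<open>U\<close>, so
  the closure of the moved set does not leave \<open>U\<close>.\<close>

lemma supp_base:
  assumes "openin X U" "x \<in> U"
  obtains f where "f \<in> carrier G" "x \<in> supp f" "supp f \<subseteq> U"
proof -
  have "neighbourhood_base_of (closedin X) X"
    using compact Hausdorff compact_Hausdorff_imp_regular_space neighbourhood_base_of_closedin by blast
  then obtain V C where VC: "openin X V" "closedin X C" "x \<in> V" "V \<subseteq> C" "C \<subseteq> U"
    using assms unfolding neighbourhood_base_of by metis
  obtain s where s: "s \<in> carrier G" "\<phi> s x \<noteq> x" "moved s \<subseteq> V"
    using swap[OF VC(1,3)] unfolding moved_def by blast
  have "x \<in> topspace X" using assms openin_subset by blast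
  then have "x \<in> moved s" using s by (auto simp: moved_def)
  then have "x \<in> supp s" using moved_subset_supp by blast
  moreover have "supp s \<subseteq> C" unfolding supp_def using s VC by (intro closure_of_minimal) auto
  ultimately show ?thesis using that s VC by blast
qed

text \<open>The supports of \<open>F\<close> are closed, and each finite intersection contains the
  nonempty support of some \<open>k\<close>; compactness gives a common point.\<close>

lemma centered_imp_subset_point_family:
  assumes c: "centered G F"
  shows "\<exists>x\<in>topspace X. F \<subseteq> point_family x"
proof -
  have F: "F \<subseteq> carrier G" using centered_subset[OF c] .
  \<comment> \<open>Adding \<open>topspace X\<close> places the common point in the space even when
    \<open>F\<close> is empty.\<close>
  let ?U = "insert (topspace X) (supp ` F)"
  have "\<Inter>\<F> \<noteq> {}" if "finite \<F> \<and> \<F> \<subseteq> ?U" for \<F>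
  proof -
    have \<F>: "finite \<F>" "\<F> \<subseteq> ?U" using that by auto
    obtain E where E: "E \<subseteq> F" "finite E" "\<F> \<inter> supp ` F = supp ` E"
      using \<F> by (metis finite_Int finite_subset_image inf_le2)
    then obtain k where k: "k \<in> carrier G" "k \<noteq> \<one>" "\<forall>e\<in>E. alg_supp_le G k e"
      using c unfolding centered_def by blast
    then have "supp k \<subseteq> supp e" if "e \<in> E" for e
      using that E F alg_supp_le_iff[of k e] by blast
    moreover have "C = topspace X \<or> C \<in> supp ` E" if "C \<in> \<F>" for C
      using that \<F>(2) E(3) by blast
    ultimately have "supp k \<subseteq> \<Inter>\<F>" using supp_subset[of k] by blast
    then show ?thesis using k supp_eq_empty_iff by blast
  qed
  then have "\<forall>\<F>. finite \<F> \<and> \<F> \<subseteq> ?U \<longrightarrow> \<Inter>\<F> \<noteq> {}" by (intro allI impI)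
  moreover have "\<forall>C\<in>?U. closedin X C" using F clopen_supp by auto
  ultimately have "\<Inter>?U \<noteq> {}"
    by (intro compact[unfolded compact_space_fip, THEN spec, THEN mp] conjI)
  then obtain x where "x \<in> topspace X" "\<And>f. f \<in> F \<Longrightarrow> x \<in> supp f" by blast
  then show ?thesis using F unfolding point_family_def by blast
qed

text \<open>Here clopenness matters: a finite intersection of supports containing \<open>x\<close>
  is a neighbourhood of \<open>x\<close>, so it contains a smaller support around
  \<open>x\<close>.\<close>

lemma centered_point_family:
  assumes x: "x \<in> topspace X"
  shows "centered G (point_family x)"
  unfolding centered_def
proof (intro conjI allI impI)
  fix E assume E: "finite E \<and> E \<subseteq> point_family x"
  have "openin X (\<Inter>(insert (topspace X) (supp ` E)))"
    using E clopen_supp by (intro openin_Inter) (auto simp: point_family_def)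
  moreover have "x \<in> \<Inter>(insert (topspace X) (supp ` E))"
    using E x by (auto simp: point_family_def)
  ultimately obtain f where f: "f \<in> carrier G" "x \<in> supp f" "supp f \<subseteq> \<Inter>(insert (topspace X) (supp ` E))"
    using supp_base by blast
  then have "f \<noteq> \<one>" using supp_eq_empty_iff by blast
  moreover have "alg_supp_le G f e" if "e \<in> E" for e
  proof -
    have "e \<in> carrier G" using that E by (auto simp: point_family_def)
    moreover have "supp f \<subseteq> supp e" using that f(3) by blast
    ultimately show ?thesis using f(1) alg_supp_le_iff by simp
  qed
  ultimately show "\<exists>k\<in>carrier G. k \<noteq> \<one> \<and> (\<forall>e\<in>E. alg_supp_le G k e)" using f by blast
qed (auto simp: point_family_def)

lemma point_family_inj:
  assumes "x \<in> topspace X" "y \<in> topspace X" "point_family x \<subseteq> point_family y"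
  shows "x = y"
proof (rule ccontr)
  assume "x \<noteq> y"
  then obtain U where U: "openin X U" "x \<in> U" "y \<notin> U"
    using Hausdorff assms unfolding Hausdorff_space_def disjnt_def by (metis IntI empty_iff)
  obtain f where "f \<in> carrier G" "x \<in> supp f" "supp f \<subseteq> U" using supp_base[OF U(1,2)] .
  then show False using assms U by (auto simp: point_family_def)
qed

text \<open>Every centered family lies in a point family, point families are centered, and distinct
  ones are incomparable.\<close>

lemma max_centered_iff: "max_centered G F \<longleftrightarrow> (\<exists>x\<in>topspace X. F = point_family x)"
proof
  assume F: "max_centered G F"
  then have "centered G F" by (rule max_centeredD)
  then obtain x where "x \<in> topspace X" "F \<subseteq> point_family x"
    using centered_imp_subset_point_family[of F] by blast
  then show "\<exists>x\<in>topspace X. F = point_family x"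
    using max_centeredD(2)[OF F centered_point_family] by blast
next
  assume "\<exists>x\<in>topspace X. F = point_family x"
  then obtain x where x: "x \<in> topspace X" "F = point_family x" by blast
  have "F' = F" if F': "centered G F'" "F \<subseteq> F'" for F'
  proof -
    obtain y where y: "y \<in> topspace X" "F' \<subseteq> point_family y"
      using centered_imp_subset_point_family[OF F'(1)] by blast
    then have "x = y" using x F' point_family_inj by blast
    then show ?thesis using x y F' by blast
  qed
  then show "max_centered G F"
    using centered_point_family[OF x(1)] x(2) unfolding max_centered_def by blast
qed

lemma act_homeomorphic:
  assumes g: "g \<in> carrier G" shows "homeomorphic_map X X (\<phi> g)"
proof -
  have "homeomorphic_maps X X (\<phi> g) (\<phi> (inv g))"
    using g continuous act_inv_left act_inv_right by (auto simp: homeomorphic_maps_def)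
  then show ?thesis using homeomorphic_maps_map by blast
qed

text \<open>Conjugation expresses the action on points inside the group, which is how equivariance
  of the point map is obtained.\<close>

lemma supp_conj:
  assumes g: "g \<in> carrier G" and f: "f \<in> carrier G" and x: "x \<in> topspace X"
  shows "\<phi> g x \<in> supp (g \<otimes> f \<otimes> inv g) \<longleftrightarrow> x \<in> supp f"
proof -
  have "moved (g \<otimes> f \<otimes> inv g) = \<phi> g ` moved f"
  proof (intro equalityI subsetI)
    fix y assume "y \<in> moved (g \<otimes> f \<otimes> inv g)"
    then have "y \<in> topspace X" "\<phi> (inv g) y \<in> moved f" using moved_conj[OF g f] by auto
    then show "y \<in> \<phi> g ` moved f" using act_inv_right[OF g] by (metis image_eqI)
  next
    fix y assume "y \<in> \<phi> g ` moved f"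
    then show "y \<in> moved (g \<otimes> f \<otimes> inv g)"
      using moved_conj[OF g f] act_inv_left[OF g] act_closed[OF g] moved_subset[of f] by auto
  qed
  then have "supp (g \<otimes> f \<otimes> inv g) = \<phi> g ` supp f"
    using homeomorphic_map_closure_of[OF act_homeomorphic[OF g] moved_subset] by (simp add: supp_def)
  then show ?thesis using x supp_subset[of f] act_inj[OF g] by (auto simp: image_iff)
qed

end

section \<open>The homeomorphism induced by an isomorphism\<close>

locale clopen_swap_action_pair =
  A: clopen_swap_action G X \<phi> + B: clopen_swap_action H Y \<rho> + group_iso_pair G H \<psi> \<psi>'
  for G (structure) and X :: "'b topology" and \<phi> and H (structure) and Y :: "'c topology" and \<rho>
    and \<psi> \<psi>'
begin

lemma flip_pair: "clopen_swap_action_pair H Y \<rho> G X \<phi> \<psi>' \<psi>"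
  by (intro clopen_swap_action_pair.intro A.clopen_swap_action_axioms B.clopen_swap_action_axioms flip)

text \<open>Existence of the chosen point comes from \<open>map_max_centered\<close>, its uniqueness
  from \<open>point_family_inj\<close>.\<close>

definition point_map :: "'b \<Rightarrow> 'c" where
  "point_map x = (SOME y. y \<in> topspace Y \<and> B.point_family y = \<psi> ` A.point_family x)"

lemma point_map:
  assumes "x \<in> topspace X"
  shows "point_map x \<in> topspace Y" "B.point_family (point_map x) = \<psi> ` A.point_family x"
proof -
  have "max_centered H (\<psi> ` A.point_family x)"
    using assms by (intro map_max_centered) (auto simp: A.max_centered_iff)
  then have "\<exists>y. y \<in> topspace Y \<and> B.point_family y = \<psi> ` A.point_family x"
    unfolding B.max_centered_iff by metis
  from someI_ex[OF this] show "point_map x \<in> topspace Y" "B.point_family (point_map x) = \<psi> ` A.point_family x"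
    unfolding point_map_def by (rule conjunct1, rule conjunct2)
qed

lemma point_map_supp_iff:
  assumes x: "x \<in> topspace X" and f: "f \<in> carrier G"
  shows "point_map x \<in> B.supp (\<psi> f) \<longleftrightarrow> x \<in> A.supp f"
proof -
  have "point_map x \<in> B.supp (\<psi> f) \<longleftrightarrow> \<psi> f \<in> \<psi> ` A.point_family x"
    unfolding point_map(2)[OF x, symmetric] B.point_family_def using closed(1)[OF f] by simp
  also have "\<dots> \<longleftrightarrow> f \<in> A.point_family x"
    by (rule inj_on_image_mem_iff[OF inj_on f]) (auto simp: A.point_family_def)
  also have "\<dots> \<longleftrightarrow> x \<in> A.supp f" using f by (simp add: A.point_family_def)
  finally show ?thesis .
qed

text \<open>One inclusion of point families already forces equality of points.\<close>

lemma point_map_unique: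
  assumes x: "x \<in> topspace X" and y: "y \<in> topspace Y"
    and supp: "\<And>f. \<lbrakk>f \<in> carrier G; x \<in> A.supp f\<rbrakk> \<Longrightarrow> y \<in> B.supp (\<psi> f)"
  shows "point_map x = y"
proof (rule B.point_family_inj[OF point_map(1)[OF x] y])
  show "B.point_family (point_map x) \<subseteq> B.point_family y"
  proof
    fix e assume "e \<in> B.point_family (point_map x)"
    then obtain f where f: "f \<in> A.point_family x" "e = \<psi> f" unfolding point_map(2)[OF x] by (rule imageE)
    then have "f \<in> carrier G" "x \<in> A.supp f" by (simp_all add: A.point_family_def)
    then show "e \<in> B.point_family y" using f(2) supp closed(1) by (simp add: B.point_family_def)
  qed
qed

lemma point_map_flip:
  assumes x: "x \<in> topspace X"
  shows "clopen_swap_action_pair.point_map H Y \<rho> G X \<phi> \<psi>' (point_map x) = x"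
proof (rule clopen_swap_action_pair.point_map_unique[OF flip_pair point_map(1)[OF x] x])
  fix f assume "f \<in> carrier H" "point_map x \<in> B.supp f"
  then show "x \<in> A.supp (\<psi>' f)" using point_map_supp_iff[OF x, of "\<psi>' f"] closed(2) inverse(2) by simp
qed

text \<open>The supports form a base, and the preimage of the support of \<open>\<psi> e\<close> is
  the open support of \<open>e\<close>.\<close>

lemma point_map_continuous: "continuous_map X Y point_map"
  unfolding continuous_map
proof (intro conjI allI impI)
  show "point_map ` topspace X \<subseteq> topspace Y" using point_map(1) by (rule image_subsetI)
  fix U assume U: "openin Y U"
  show "openin X {x \<in> topspace X. point_map x \<in> U}"
  proof (subst openin_subopen, intro ballI)
    fix x assume "x \<in> {x \<in> topspace X. point_map x \<in> U}"
    then have x: "x \<in> topspace X" "point_map x \<in> U" by auto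
    obtain f where f: "f \<in> carrier H" "point_map x \<in> B.supp f" "B.supp f \<subseteq> U"
      using B.supp_base[OF U x(2)] .
    define e where "e = \<psi>' f"
    have e: "e \<in> carrier G" "f = \<psi> e" using f closed inverse by (auto simp: e_def)
    have "A.supp e \<subseteq> {x \<in> topspace X. point_map x \<in> U}"
    proof
      fix y assume y: "y \<in> A.supp e"
      then have "y \<in> topspace X" using A.supp_subset[of e] by blast
      then show "y \<in> {x \<in> topspace X. point_map x \<in> U}" using y e f(3) point_map_supp_iff[of y e] by auto
    qed
    moreover have "x \<in> A.supp e" using point_map_supp_iff[OF x(1) e(1)] e(2) f(2) by simp
    ultimately show "\<exists>T. openin X T \<and> x \<in> T \<and> T \<subseteq> {x \<in> topspace X. point_map x \<in> U}"
      using A.clopen_supp(1)[OF e(1)] by blast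
  qed
qed

lemma point_map_homeomorphic: "homeomorphic_map X Y point_map"
proof -
  interpret F: clopen_swap_action_pair H Y \<rho> G X \<phi> \<psi>' \<psi> by (rule flip_pair)
  have "homeomorphic_maps X Y point_map F.point_map"
    using point_map_continuous F.point_map_continuous point_map_flip F.point_map_flip by (auto simp: homeomorphic_maps_def)
  then show ?thesis using homeomorphic_maps_map by blast
qed

text \<open>If \<open>f\<close> has \<open>\<phi> g x\<close> in its support, its conjugate
  \<open>e\<close> by \<open>inv g\<close> has \<open>x\<close> there; apply \<open>\<psi>\<close>
  to \<open>e\<close> and conjugate back by \<open>\<psi> g\<close>.\<close>

lemma point_map_equivariant:
  assumes g: "g \<in> carrier G" and x: "x \<in> topspace X"
  shows "point_map (\<phi> g x) = \<rho> (\<psi> g) (point_map x)"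
proof (rule point_map_unique[OF A.act_closed[OF g x] B.act_closed[OF closed(1)[OF g] point_map(1)[OF x]]])
  fix f assume f: "f \<in> carrier G" "\<phi> g x \<in> A.supp f"
  define e where "e = inv g \<otimes> f \<otimes> g"
  have e: "e \<in> carrier G" "f = g \<otimes> e \<otimes> inv g"
    using f g by (simp_all add: e_def A.m_assoc[symmetric]) (simp add: A.m_assoc)
  then have "x \<in> A.supp e" using A.supp_conj[OF g e(1) x] f(2) by simp
  then have "point_map x \<in> B.supp (\<psi> e)" using point_map_supp_iff[OF x e(1)] by simp
  then have "\<rho> (\<psi> g) (point_map x) \<in> B.supp (\<psi> g \<otimes>\<^bsub>H\<^esub> \<psi> e \<otimes>\<^bsub>H\<^esub> inv\<^bsub>H\<^esub> (\<psi> g))"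
    using B.supp_conj[of "\<psi> g" "\<psi> e" "point_map x"] point_map(1)[OF x] e g closed by simp
  then show "\<rho> (\<psi> g) (point_map x) \<in> B.supp (\<psi> f)" using e g by simp
qed

end


subsection \<open>Full groups of topological Markov shifts\<close>

lemma funpow_shift: "(shift ^^ n) x = (\<lambda>i. x (n + i))"
  by (induction n) (simp_all add: shift_def)

lemma topspace_markov_space:
  "x \<in> topspace (markov_space A) \<longleftrightarrow>
     (\<forall>n. x n < dim_row A) \<and> (\<forall>n. A $$ (x n, x (Suc n)) = 1)"
  by (auto simp: markov_space_def PiE_iff)

lemma continuous_map_coordinate:
  "continuous_map (markov_space A) (discrete_topology {0..<dim_row A}) (\<lambda>x. x i)"
  unfolding markov_space_def
  by (intro continuous_map_from_subtopology continuous_map_product_projection) simp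

lemma openin_markov_coordinate: "openin (markov_space A) {x \<in> topspace (markov_space A). P (x i)}"
proof -
  have "openin (markov_space A) {x \<in> topspace (markov_space A). x i \<in> {a \<in> {0..<dim_row A}. P a}}"
    by (intro openin_continuous_map_preimage[OF continuous_map_coordinate]) auto
  moreover have "{x \<in> topspace (markov_space A). x i \<in> {a \<in> {0..<dim_row A}. P a}} =
      {x \<in> topspace (markov_space A). P (x i)}"
    by (auto simp: topspace_markov_space)
  ultimately show ?thesis by simp
qed

lemma openin_markov_cylinder:
  "openin (markov_space A) {y \<in> topspace (markov_space A). \<forall>i<n. y i = x i}"
proof -
  have "openin (markov_space A)
      (\<Inter>(insert (topspace (markov_space A)) ((\<lambda>i. {y \<in> topspace (markov_space A). y i = x i}) ` {..<n})))"
    by (intro openin_Inter) (auto intro: openin_markov_coordinate)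
  moreover have "\<Inter>(insert (topspace (markov_space A)) ((\<lambda>i. {y \<in> topspace (markov_space A). y i = x i}) ` {..<n}))
      = {y \<in> topspace (markov_space A). \<forall>i<n. y i = x i}"
    by auto
  ultimately show ?thesis by simp
qed

lemma markov_cylinder_base:
  assumes U: "openin (markov_space A) U" and x: "x \<in> U"
  obtains n where "{y \<in> topspace (markov_space A). \<forall>i<n. y i = x i} \<subseteq> U"
proof -
  let ?T = "\<lambda>_::nat. discrete_topology {0..<dim_row A}"
  let ?S = "{x. \<forall>n. A $$ (x n, x (Suc n)) = 1}"
  obtain V where V: "openin (product_topology ?T UNIV) V" "U = V \<inter> ?S"
    using U unfolding markov_space_def openin_subtopology by (elim exE conjE)
  then have "x \<in> V" using x by simp
  then obtain C where C: "x \<in> (\<Pi>\<^sub>E i\<in>UNIV. C i)" "finite {i. C i \<noteq> topspace (?T i)}"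
      "(\<Pi>\<^sub>E i\<in>UNIV. C i) \<subseteq> V"
    using product_topology_open_contains_basis[OF V(1), of x] by metis
  obtain n where n: "\<forall>i\<in>{i. C i \<noteq> topspace (?T i)}. i < n"
    using C(2) finite_nat_set_iff_bounded by blast
  have "y \<in> U" if y: "y \<in> topspace (markov_space A)" "\<forall>i<n. y i = x i" for y
  proof -
    have "y i \<in> C i" for i
    proof (cases "i < n")
      case True
      then show ?thesis using y C(1) by (auto simp: PiE_iff)
    next
      case False
      then have "C i = {0..<dim_row A}" using n by auto
      then show ?thesis using y by (simp add: topspace_markov_space)
    qed
    then have "y \<in> V" using C(3) by (auto simp: PiE_iff)
    then show ?thesis using y V(2) by (simp add: topspace_markov_space)
  qed
  then show ?thesis using that by blast
qed

lemma continuous_map_into_markov: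
  assumes "\<And>x. x \<in> topspace X \<Longrightarrow> f x \<in> topspace (markov_space A)"
    and "\<And>i a. openin X {x \<in> topspace X. f x i = a}"
  shows "continuous_map X (markov_space A) f"
proof -
  have "continuous_map X (discrete_topology {0..<dim_row A}) (\<lambda>x. f x i)" for i
    unfolding continuous_map
  proof (intro conjI allI impI)
    fix U
    have "openin X (\<Union>a\<in>U. {x \<in> topspace X. f x i = a})" using assms(2) by blast
    moreover have "(\<Union>a\<in>U. {x \<in> topspace X. f x i = a}) = {x \<in> topspace X. f x i \<in> U}" by auto
    ultimately show "openin X {x \<in> topspace X. f x i \<in> U}" by simp
  qed (use assms(1) topspace_markov_space in auto)
  then show ?thesis
    using assms(1) unfolding markov_space_def
    by (auto simp: continuous_map_in_subtopology continuous_map_componentwise_UNIV)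
qed

text \<open>A basic open set leaves some coordinate unrestricted, and that coordinate can be
  flipped.\<close>

lemma cantor_space_no_isolated: "\<not> openin cantor_space {c}"
proof
  assume "openin cantor_space {c}"
  then obtain C where C: "c \<in> (\<Pi>\<^sub>E i\<in>UNIV. C i)" "finite {i. C i \<noteq> (UNIV :: bool set)}"
      "(\<Pi>\<^sub>E i\<in>UNIV. C i) \<subseteq> {c}"
    using product_topology_open_contains_basis[of "\<lambda>_. discrete_topology UNIV" UNIV "{c}" c]
    unfolding cantor_space_def by auto
  obtain i where i: "C i = UNIV" using ex_new_if_finite[OF infinite_UNIV_nat C(2)] by auto
  have "c(i := \<not> c i) \<in> (\<Pi>\<^sub>E i\<in>UNIV. C i)" using C(1) i by (auto simp: PiE_iff)
  then have "c(i := \<not> c i) = c" using C(3) by blast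
  then show False by (metis fun_upd_same)
qed

text \<open>Condition (I) enters the proof only through these three properties, transported from the
  Cantor space.\<close>

lemma
  assumes "condition_I A"
  shows compact_markov_space: "compact_space (markov_space A)"
    and Hausdorff_markov_space: "Hausdorff_space (markov_space A)"
    and markov_space_no_isolated: "\<not> openin (markov_space A) {x}"
proof -
  have hom: "markov_space A homeomorphic_space cantor_space" using assms by (simp add: condition_I_def)
  have "compact_space cantor_space"
    by (simp add: cantor_space_def compact_space_product_topology compact_space_discrete_topology)
  then show "compact_space (markov_space A)" using hom homeomorphic_compact_space by blast
  have "Hausdorff_space cantor_space"
    by (simp add: cantor_space_def Hausdorff_space_product_topology)
  then show "Hausdorff_space (markov_space A)" using hom homeomorphic_Hausdorff_space by blast
  obtain h where h: "homeomorphic_map (markov_space A) cantor_space h"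
    using hom homeomorphic_space by blast
  show "\<not> openin (markov_space A) {x}"
  proof
    assume o: "openin (markov_space A) {x}"
    then have "openin cantor_space (h ` {x})"
      using h homeomorphic_imp_open_map unfolding open_map_def by blast
    then show False using cantor_space_no_isolated by simp
  qed
qed

text \<open>From index \<open>max a b\<close> on, every letter repeats an earlier one at a fixed
  distance, so the initial letters determine the sequence.\<close>

lemma eventually_periodic_unique:
  fixes x y :: "nat \<Rightarrow> 'a"
  assumes "a \<noteq> b" and y: "\<And>i. y (a + i) = y (b + i)" and x: "\<And>i. x (a + i) = x (b + i)"
    and eq: "\<And>i. i < max a b \<Longrightarrow> y i = x i"
  shows "y = x"
proof
  define p q where "p = min a b" and "q = max a b"
  have pq: "p < q" "\<And>i. y (p + i) = y (q + i)" "\<And>i. x (p + i) = x (q + i)"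
    using assms(1) x y by (auto simp: p_def q_def min_def max_def)
  show "y i = x i" for i
  proof (induction i rule: less_induct)
    case (less i)
    show ?case
    proof (cases "i < q")
      case False
      then have "i = q + (i - q)" "p + (i - q) < i" using pq(1) by auto
      then show ?thesis using pq(2,3)[of "i - q"] less[of "p + (i - q)"] by metis
    qed (simp add: eq q_def)
  qed
qed

text \<open>Near a fixed point either \<open>k = l\<close> and \<open>\<tau>\<close> is locally the identity, or \<open>k \<noteq> l\<close> and a nearby fixed
  point is eventually periodic and determined by its first \<open>max k l\<close> letters, so it is isolated among
  the fixed points.\<close>

lemma openin_support_full_group:
  assumes \<tau>: "\<tau> \<in> full_group_set A" and H: "Hausdorff_space (markov_space A)"
  defines "X \<equiv> markov_space A"
  shows "openin X (X closure_of {x \<in> topspace X. \<tau> x \<noteq> x})" (is "openin X (X closure_of ?D)")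
proof -
  have cont: "continuous_map X X \<tau>"
    using \<tau> homeomorphic_imp_continuous_map by (auto simp: full_group_set_def X_def)
  obtain k l where k: "continuous_map X (discrete_topology (UNIV :: nat set)) k"
    and l: "continuous_map X (discrete_topology (UNIV :: nat set)) l"
    and kl: "\<And>x. x \<in> topspace X \<Longrightarrow> (shift ^^ k x) (\<tau> x) = (shift ^^ l x) x"
    using \<tau> by (auto simp: full_group_set_def X_def)
  have kl': "\<tau> x (k x + i) = x (l x + i)" if "x \<in> topspace X" for x i
    using kl[OF that] unfolding funpow_shift by (rule fun_cong)
  have D: "?D \<subseteq> X closure_of ?D" by (intro closure_of_subset) auto
  have "closedin X {x \<in> topspace X. \<tau> x = id x}"
    using closedin_continuous_maps_eq[OF H cont[unfolded X_def] continuous_map_id] by (simp add: X_def)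
  moreover have "?D = topspace X - {x \<in> topspace X. \<tau> x = id x}" by auto
  ultimately have oD: "openin X ?D" by auto
  show ?thesis
  proof (subst openin_subopen, intro ballI)
    fix x assume x: "x \<in> X closure_of ?D"
    then have xX: "x \<in> topspace X" by (simp add: in_closure_of)
    show "\<exists>T. openin X T \<and> x \<in> T \<and> T \<subseteq> X closure_of ?D"
    proof (cases "\<tau> x = x")
      case False
      then show ?thesis using oD xX D by blast
    next
      case fixed: True
      define m where "m = max (k x) (l x)"
      define C where "C = {y \<in> topspace X. \<forall>i<m. y i = x i}"
      \<comment> \<open>On \<open>V\<close> the exponents keep their values at \<open>x\<close>, and
        both \<open>y\<close> and \<open>\<tau> y\<close> share with \<open>x\<close> the first
        \<open>m\<close> letters, which the shift relation does not control.\<close>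
      define V where "V = C \<inter> {y \<in> topspace X. \<tau> y \<in> C} \<inter> {y \<in> topspace X. k y \<in> {k x}}
        \<inter> {y \<in> topspace X. l y \<in> {l x}}"
      have oC: "openin X C" unfolding C_def X_def by (rule openin_markov_cylinder)
      have oV: "openin X V"
        unfolding V_def
        by (intro openin_Int oC openin_continuous_map_preimage[OF cont]
            openin_continuous_map_preimage[OF k] openin_continuous_map_preimage[OF l]) auto
      have xV: "x \<in> V" using xX fixed by (auto simp: V_def C_def)
      have "k x \<noteq> l x"
      proof
        assume eq: "k x = l x"
        have "\<tau> y = y" if y: "y \<in> V" for y
        proof
          fix i
          have yV: "y \<in> topspace X" "k y = k x" "l y = l x" "\<forall>i<m. y i = x i" "\<forall>i<m. \<tau> y i = x i"
            using y by (auto simp: V_def C_def)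
          show "\<tau> y i = y i"
          proof (cases "i < m")
            case False
            then show ?thesis using kl'[OF yV(1), of "i - k x"] yV eq by (simp add: m_def)
          qed (use yV in auto)
        qed
        then have "V \<inter> ?D = {}" by auto
        then show False using x oV xV by (auto simp: in_closure_of)
      qed
      have "V - {x} \<subseteq> ?D"
      proof
        fix y assume y: "y \<in> V - {x}"
        then have yV: "y \<in> topspace X" "k y = k x" "l y = l x" "\<forall>i<m. y i = x i"
          by (auto simp: V_def C_def)
        have "\<tau> y \<noteq> y"
        proof
          assume "\<tau> y = y"
          then have "y = x"
            using \<open>k x \<noteq> l x\<close> kl'[OF yV(1)] kl'[OF xX] yV fixed
            by (intro eventually_periodic_unique[of "k x" "l x"]) (auto simp: m_def)
          then show False using y by blast
        qed
        then show "y \<in> ?D" using yV by blast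
      qed
      then have "V \<subseteq> X closure_of ?D" using D x by blast
      then show ?thesis using oV xV by blast
    qed
  qed
qed

section \<open>Involutions exchanging prefixes\<close>

lemma matrix_power_pos_path:
  fixes A :: "nat mat"
  assumes A: "A \<in> carrier_mat N N" and a: "a < N"
  shows "\<lbrakk>b < N; (A ^\<^sub>m m) $$ (a, b) > 0\<rbrakk> \<Longrightarrow>
    \<exists>w. w 0 = a \<and> w m = b \<and> (\<forall>i\<le>m. w i < N) \<and> (\<forall>i<m. A $$ (w i, w (Suc i)) > 0)"
proof (induction m arbitrary: b)
  case 0
  then show ?case using A a by (intro exI[of _ "\<lambda>_. a"]) (auto split: if_splits)
next
  case (Suc m)
  have P: "A ^\<^sub>m m \<in> carrier_mat N N" using A by simp
  have "(A ^\<^sub>m Suc m) $$ (a, b) = (\<Sum>c = 0..<N. (A ^\<^sub>m m) $$ (a, c) * A $$ (c, b))"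
    using A P a Suc.prems by (simp add: scalar_prod_def)
  then obtain c where c: "c < N" "(A ^\<^sub>m m) $$ (a, c) > 0" "A $$ (c, b) > 0"
    using Suc.prems(2) by (auto simp: sum_eq_0_iff neq0_conv[symmetric] simp del: neq0_conv)
  obtain w where w: "w 0 = a" "w m = c" "\<forall>i\<le>m. w i < N" "\<forall>i<m. A $$ (w i, w (Suc i)) > 0"
    using Suc.IH[OF c(1,2)] by blast
  then show ?case
    using c Suc.prems
    by (intro exI[of _ "w(Suc m := b)"]) (auto simp: le_Suc_eq less_Suc_eq)
qed

definition prefix_replace ::
    "(nat \<Rightarrow> nat) \<Rightarrow> nat \<Rightarrow> (nat \<Rightarrow> nat) \<Rightarrow> nat \<Rightarrow> (nat \<Rightarrow> nat)" where
  "prefix_replace z q y p = (\<lambda>i. if i < q then z i else y (p + (i - q)))"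

text \<open>The exchanged words have lengths \<open>p + 1\<close> and \<open>q + 1\<close> and
  include their common last letter, hence the tests with \<le>. \<open>prefix_replace\<close> cuts
  just before that letter, which is kept as the first letter of the tail.\<close>

definition prefix_swap ::
    "nat mat \<Rightarrow> (nat \<Rightarrow> nat) \<Rightarrow> nat \<Rightarrow> (nat \<Rightarrow> nat) \<Rightarrow> nat \<Rightarrow> (nat \<Rightarrow> nat) \<Rightarrow> (nat \<Rightarrow> nat)" where
  "prefix_swap A x p z q = (\<lambda>y\<in>topspace (markov_space A).
     if \<forall>i\<le>p. y i = x i then prefix_replace z q y p
     else if \<forall>i\<le>q. y i = z i then prefix_replace x p y q else y)"

text \<open>The transition across the cut ends in \<open>y p = z q\<close>, so it already occurs in
  \<open>z\<close>.\<close>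

lemma prefix_replace_closed:
  assumes "z \<in> topspace (markov_space A)" "y \<in> topspace (markov_space A)" "y p = z q"
  shows "prefix_replace z q y p \<in> topspace (markov_space A)"
  unfolding topspace_markov_space
proof (intro conjI allI)
  fix n
  show "prefix_replace z q y p n < dim_row A"
    using assms by (auto simp: prefix_replace_def topspace_markov_space)
  consider "Suc n < q" | "Suc n = q" | "q \<le> n" by linarith
  then show "A $$ (prefix_replace z q y p n, prefix_replace z q y p (Suc n)) = 1"
  proof cases
    case 2
    then have "A $$ (z n, z q) = 1" using assms(1) by (auto simp: topspace_markov_space)
    then show ?thesis using 2 assms(3) by (auto simp: prefix_replace_def)
  qed (use assms in \<open>auto simp: prefix_replace_def topspace_markov_space Suc_diff_le\<close>)
qed

context
  fixes A :: "nat mat" and x z :: "nat \<Rightarrow> nat" and p q j :: nat and X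
  defines "X \<equiv> markov_space A"
  assumes xz: "x \<in> topspace X" "z \<in> topspace X"
    and meet: "x p = z q" and incomp: "j \<le> p" "j \<le> q" "x j \<noteq> z j"
begin

text \<open>The words differ at position \<open>j\<close>, so their cylinders are disjoint and the
  three cases are exclusive.\<close>

lemma prefix_swap_cases:
  assumes y: "y \<in> topspace X"
  obtains (x) "\<forall>i\<le>p. y i = x i" "\<not> (\<forall>i\<le>q. y i = z i)" "prefix_swap A x p z q y = prefix_replace z q y p"
  | (z) "\<not> (\<forall>i\<le>p. y i = x i)" "\<forall>i\<le>q. y i = z i" "prefix_swap A x p z q y = prefix_replace x p y q"
  | (other) "\<not> (\<forall>i\<le>p. y i = x i)" "\<not> (\<forall>i\<le>q. y i = z i)" "prefix_swap A x p z q y = y"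
proof -
  let ?P = "\<forall>i\<le>p. y i = x i" and ?Q = "\<forall>i\<le>q. y i = z i"
  have disj: "\<not> (?P \<and> ?Q)" using incomp by metis
  have eq: "prefix_swap A x p z q y =
     (if ?P then prefix_replace z q y p else if ?Q then prefix_replace x p y q else y)"
    using y by (simp add: prefix_swap_def X_def)
  show ?thesis
  proof (cases ?P)
    case True
    show ?thesis using disj True eq[unfolded if_P[OF True]] by (intro that(1)) blast+
  next
    case P: False
    show ?thesis
    proof (cases ?Q)
      case True
      show ?thesis using P True eq[unfolded if_not_P[OF P] if_P[OF True]] by (rule that(2))
    next
      case False
      show ?thesis using P False eq[unfolded if_not_P[OF P] if_not_P[OF False]] by (rule that(3))
    qed
  qed
qed

lemma prefix_swap_closed:
  assumes y: "y \<in> topspace X"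
  shows "prefix_swap A x p z q y \<in> topspace X"
  using y
proof (cases rule: prefix_swap_cases)
  case x
  then show ?thesis using prefix_replace_closed xz y meet by (simp add: X_def)
next
  case z
  then show ?thesis using prefix_replace_closed xz y meet by (simp add: X_def)
qed (use y in simp)

lemma prefix_swap_involution:
  assumes y: "y \<in> topspace X"
  shows "prefix_swap A x p z q (prefix_swap A x p z q y) = y"
  using y
proof (cases rule: prefix_swap_cases)
  case x
  let ?y = "prefix_swap A x p z q y"
  have "\<forall>i\<le>q. ?y i = z i" using x meet by (auto simp: prefix_replace_def)
  then have "prefix_swap A x p z q ?y = prefix_replace x p ?y q"
    by (cases rule: prefix_swap_cases[OF prefix_swap_closed[OF y]]) auto
  also have "\<dots> = y" using x by (auto simp: prefix_replace_def fun_eq_iff)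
  finally show ?thesis .
next
  case z
  let ?y = "prefix_swap A x p z q y"
  have "\<forall>i\<le>p. ?y i = x i" using z meet by (auto simp: prefix_replace_def)
  then have "prefix_swap A x p z q ?y = prefix_replace z q ?y p"
    by (cases rule: prefix_swap_cases[OF prefix_swap_closed[OF y]]) auto
  also have "\<dots> = y" using z by (auto simp: prefix_replace_def fun_eq_iff)
  finally show ?thesis .
qed simp

text \<open>On each of three clopen pieces the map replaces a prefix of one fixed length by one of
  another fixed length, or is the identity, so the exponents can be taken locally constant.\<close>

lemma prefix_swap_full_group: "prefix_swap A x p z q \<in> full_group_set A"
proof -
  let ?s = "prefix_swap A x p z q"
  let ?U = "\<lambda>n w. {y \<in> topspace X. \<forall>i\<le>n. y i = w i}"
  have oU: "openin X (?U n w)" for n w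
    using openin_markov_cylinder[of A "Suc n" w] by (simp add: X_def less_Suc_eq_le)
  \<comment> \<open>A point outside the cylinder already differs from \<open>w\<close> within its
    first \<open>n + 1\<close> letters, so its own cylinder stays outside.\<close>
  have oUc: "openin X (topspace X - ?U n w)" for n w
  proof (subst openin_subopen, intro ballI)
    fix y assume y: "y \<in> topspace X - ?U n w"
    then show "\<exists>T. openin X T \<and> y \<in> T \<and> T \<subseteq> topspace X - ?U n w"
      using oU[of n y] by (intro exI[of _ "?U n y"]) auto
  qed
  let ?O = "(topspace X - ?U p x) \<inter> (topspace X - ?U q z)"
  have local_const: "openin X {y \<in> topspace X. Q y}"
    if "openin X {y \<in> topspace X. Qx y}" "openin X {y \<in> topspace X. Qz y}"
      "openin X {y \<in> topspace X. Qo y}"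
      and "\<And>y. y \<in> ?U p x \<Longrightarrow> Q y = Qx y" "\<And>y. y \<in> ?U q z \<Longrightarrow> Q y = Qz y"
        "\<And>y. y \<in> ?O \<Longrightarrow> Q y = Qo y" for Q Qx Qz Qo
  proof -
    have "{y \<in> topspace X. Q y} = (?U p x \<inter> {y \<in> topspace X. Qx y}) \<union> (?U q z \<inter> {y \<in> topspace X. Qz y})
        \<union> (?O \<inter> {y \<in> topspace X. Qo y})"
      using that(4-6) by blast
    moreover have "openin X \<dots>" by (intro openin_Un openin_Int oU oUc that(1-3))
    ultimately show ?thesis by simp
  qed
  have sx: "?s y = prefix_replace z q y p" if "y \<in> ?U p x" for y
    using that by (simp add: prefix_swap_def X_def)
  have sz: "?s y = prefix_replace x p y q" and nx: "\<not> (\<forall>i\<le>p. y i = x i)" if "y \<in> ?U q z" for y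
    using that prefix_swap_cases[of y] by auto
  have so: "?s y = y" if "y \<in> ?O" for y
    using that prefix_swap_cases[of y] by auto
  have cont: "continuous_map X X ?s"
    unfolding X_def
  proof (rule continuous_map_into_markov; fold X_def)
    fix i a
    have coord: "openin X {y \<in> topspace X. y n = a}" for n
      unfolding X_def by (rule openin_markov_coordinate)
    have replace: "openin X {y \<in> topspace X. prefix_replace w n y m i = a}" for w n m
      using coord by (cases "i < n"; cases "w i = a") (simp_all add: prefix_replace_def)
    show "openin X {y \<in> topspace X. ?s y i = a}"
      by (rule local_const[OF replace[of z q p] replace[of x p q] coord[of i]]) (simp_all only: sx sz so)
  qed (use prefix_swap_closed in auto)
  then have "homeomorphic_maps X X ?s ?s"
    using prefix_swap_involution by (auto simp: homeomorphic_maps_def)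
  then have hom: "homeomorphic_map X X ?s" using homeomorphic_maps_map by blast
  have lag: "continuous_map X (discrete_topology UNIV)
      (\<lambda>y. if \<forall>i\<le>p. y i = x i then b else if \<forall>i\<le>q. y i = z i then c else (0::nat))" for b c
    unfolding continuous_map
  proof (intro conjI allI impI)
    fix S :: "nat set"
    have const: "openin X {y \<in> topspace X. e}" for e by (cases e) simp_all
    show "openin X {y \<in> topspace X. (if \<forall>i\<le>p. y i = x i then b
        else if \<forall>i\<le>q. y i = z i then c else 0) \<in> S}"
      by (rule local_const[OF const[of "b \<in> S"] const[of "c \<in> S"] const[of "0 \<in> S"]])
        (use nx in auto)
  qed auto
  \<comment> \<open>On the cylinder of \<open>x\<close>, dropping the \<open>q\<close> new letters
    of the image leaves the same tail as dropping \<open>p\<close> letters of the point; on the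
    cylinder of \<open>z\<close> the roles are reversed.\<close>
  define k where "k y = (if \<forall>i\<le>p. y i = x i then q else if \<forall>i\<le>q. y i = z i then p else 0)" for y :: "nat \<Rightarrow> nat"
  define l where "l y = (if \<forall>i\<le>p. y i = x i then p else if \<forall>i\<le>q. y i = z i then q else 0)" for y :: "nat \<Rightarrow> nat"
  have k: "continuous_map X (discrete_topology UNIV) k"
    and l: "continuous_map X (discrete_topology UNIV) l"
    unfolding k_def l_def by (rule lag)+
  have eq: "(shift ^^ k y) (?s y) = (shift ^^ l y) y" if y: "y \<in> topspace X" for y
    using y
  proof (cases rule: prefix_swap_cases)
    case x
    have "k y = q" "l y = p" unfolding k_def l_def if_P[OF x(1)] by (rule refl)+
    then show ?thesis using x(3) by (simp add: funpow_shift prefix_replace_def)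
  next
    case z
    have "k y = p" "l y = q" unfolding k_def l_def if_not_P[OF z(1)] if_P[OF z(2)] by (rule refl)+
    then show ?thesis using z(3) by (simp add: funpow_shift prefix_replace_def)
  next
    case other
    have "k y = 0" "l y = 0"
      unfolding k_def l_def if_not_P[OF other(1)] if_not_P[OF other(2)] by (rule refl)+
    then show ?thesis using other(3) by simp
  qed
  show ?thesis
    by (rule full_group_setI[of _ _ k l]) (use hom k l eq in \<open>simp_all add: X_def prefix_swap_def\<close>)
qed

end

text \<open>As \<open>x\<close> is not isolated, some \<open>y\<close> in its cylinder first leaves
  it at a position \<open>j\<close>, and irreducibility gives a path from \<open>y j\<close> back to
  \<open>x j\<close>. Following \<open>y\<close> and then this path yields a word incomparable with
  the prefix of \<open>x\<close> up to \<open>j\<close> but ending in the same letter.\<close>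

lemma full_group_swap:
  assumes A: "zero_one_matrix N A" "irreducible_matrix A" "condition_I A"
    and U: "openin (markov_space A) U" "x \<in> U"
  shows "\<exists>s\<in>full_group_set A. (\<forall>y\<in>topspace (markov_space A). s (s y) = y) \<and> s x \<noteq> x \<and>
      {y \<in> topspace (markov_space A). s y \<noteq> y} \<subseteq> U"
proof -
  let ?X = "markov_space A"
  have car: "A \<in> carrier_mat N N" "dim_row A = N" using A(1) by (auto simp: zero_one_matrix_def)
  have x: "x \<in> topspace ?X" using U openin_subset by blast
  obtain n where n: "{y \<in> topspace ?X. \<forall>i<n. y i = x i} \<subseteq> U"
    using markov_cylinder_base[OF U] .
  have "{y \<in> topspace ?X. \<forall>i<n. y i = x i} \<noteq> {x}"
    using markov_space_no_isolated[OF A(3), of x] openin_markov_cylinder[of A n x] by metis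
  then obtain y where y: "y \<in> topspace ?X" "\<forall>i<n. y i = x i" "y \<noteq> x"
    using x by blast
  define j where "j = (LEAST i. y i \<noteq> x i)"
  have "\<exists>i. y i \<noteq> x i" using y(3) by auto
  then have j: "y j \<noteq> x j" unfolding j_def by (rule LeastI_ex)
  have before_j: "\<And>i. i < j \<Longrightarrow> y i = x i" unfolding j_def by (blast dest: not_less_Least)
  have nj: "n \<le> j" using j y(2) by (meson not_le)
  have lt: "x i < N" "y i < N" for i using x y car by (auto simp: topspace_markov_space)
  obtain m where "m > 0" "(A ^\<^sub>m m) $$ (y j, x j) > 0"
    using A(2) lt[of j] car unfolding irreducible_matrix_def by metis
  then obtain w where w: "w 0 = y j" "w m = x j" "\<forall>i\<le>m. w i < N" "\<forall>i<m. A $$ (w i, w (Suc i)) > 0"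
    using matrix_power_pos_path[OF car(1) lt(2)[of j] lt(1)[of j]] by blast
  have w1: "A $$ (w i, w (Suc i)) = 1" if "i < m" for i
  proof -
    have "w i < N" "w (Suc i) < N" using that w(3) by auto
    then have "A $$ (w i, w (Suc i)) \<in> {0, 1}" using A(1) unfolding zero_one_matrix_def by blast
    then show ?thesis using w(4) that by fastforce
  qed
  define q where "q = j + m"
  \<comment> \<open>The sequence follows \<open>y\<close> before \<open>j\<close>, the path
    \<open>w\<close> from \<open>j\<close> to \<open>q\<close>, and the tail of \<open>x\<close>
    afterwards; the last part makes it an infinite admissible sequence.\<close>
  define v where "v = prefix_replace y j (\<lambda>i. if i \<le> m then w i else x (j + (i - m))) 0"
  have v: "v i = (if i < j then y i else if i \<le> q then w (i - j) else x (i - m))" for i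
    by (auto simp: v_def prefix_replace_def q_def)
  have vX: "v \<in> topspace ?X"
    unfolding topspace_markov_space
  proof (intro conjI allI)
    fix i
    show "v i < dim_row A" using lt w(3) car by (auto simp: v q_def)
    have yi: "A $$ (y i, y (Suc i)) = 1" and xi: "A $$ (x (i - m), x (Suc (i - m))) = 1"
      using x y by (auto simp: topspace_markov_space)
    consider "Suc i < j" | "Suc i = j" | "j \<le> i" "i < q" | "i = q" | "i > q" by linarith
    then show "A $$ (v i, v (Suc i)) = 1"
    proof cases
      case 2
      then show ?thesis using yi w(1) by (auto simp: v q_def)
    next
      case 3
      then show ?thesis using w1[of "i - j"] by (auto simp: v q_def Suc_diff_le)
    next
      case 4
      then show ?thesis using xi w(2) by (auto simp: v q_def Suc_diff_le)
    next
      case 5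
      then show ?thesis using xi by (auto simp: v q_def Suc_diff_le)
    qed (use yi in \<open>auto simp: v\<close>)
  qed
  let ?s = "prefix_swap A x j v q"
  have meet: "x j = v q" "j \<le> j" "j \<le> q" "x j \<noteq> v j"
    using w j by (auto simp: v q_def)
  have vn: "v i = x i" if "i < n" for i using that nj before_j by (auto simp: v)
  have "?s x \<noteq> x"
  proof -
    have "?s x = prefix_replace v q x j" using x by (simp add: prefix_swap_def)
    moreover have "prefix_replace v q x j j \<noteq> x j"
    \<comment> \<open>For \<open>m = 0\<close> the path would identify the distinct letters
      \<open>y j\<close> and \<open>x j\<close>; otherwise \<open>j < q\<close>, so position
      \<open>j\<close> of the image carries \<open>v j\<close>.\<close>
    proof (cases "m = 0")
      case True
      then show ?thesis using w j by simp
    next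
      case False
      then show ?thesis using meet by (simp add: prefix_replace_def q_def)
    qed
    ultimately show ?thesis by metis
  qed
  moreover have "{y \<in> topspace ?X. ?s y \<noteq> y} \<subseteq> U"
  proof
    fix t assume t: "t \<in> {y \<in> topspace ?X. ?s y \<noteq> y}"
    then have tX: "t \<in> topspace ?X" by simp
    \<comment> \<open>A moved point begins with one of the two words, and both agree with
      \<open>x\<close> on the first \<open>n\<close> letters because
      \<open>n \<le> j\<close>.\<close>
    have "\<forall>i<n. t i = x i"
      using t vn nj q_def prefix_swap_cases[OF x vX meet tX] by (smt (verit) le_add1 le_trans less_or_eq_imp_le mem_Collect_eq)
    then show "t \<in> U" using tX n by blast
  qed
  moreover have "?s \<in> full_group_set A" using prefix_swap_full_group[OF x vX meet] .
  moreover have "\<forall>y\<in>topspace ?X. ?s (?s y) = y" using prefix_swap_involution[OF x vX meet] by blast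
  ultimately show ?thesis by blast
qed

section \<open>Group isomorphism and spatial isomorphism\<close>

lemma carrier_full_group: "carrier (full_group A) = full_group_set A"
  by (simp add: full_group_def)

lemma mult_full_group:
  "\<lbrakk>g \<in> full_group_set A; f \<in> full_group_set A\<rbrakk> \<Longrightarrow>
     g \<otimes>\<^bsub>full_group A\<^esub> f = compose (topspace (markov_space A)) g f"
  using full_group_set_subset_Bij by (auto simp: full_group_def BijGroup_def subset_iff)

lemma clopen_swap_action_full_group:
  assumes "zero_one_matrix N A" "irreducible_matrix A" "condition_I A"
  shows "clopen_swap_action (full_group A) (markov_space A) (\<lambda>g. g)"
proof (intro clopen_swap_action.intro faithful_action.intro clopen_swap_action_axioms.intro
    group_action.intro faithful_action_axioms.intro)
  let ?X = "markov_space A"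
  show "group_hom (full_group A) (BijGroup (topspace ?X)) (\<lambda>g. g)"
    using full_group_set_subset_Bij[of A]
    by (intro group_hom.intro group_hom_axioms.intro group_full_group group_BijGroup)
      (auto simp: hom_def full_group_def BijGroup_def)
  show "inj_on (\<lambda>g. g) (carrier (full_group A))" by simp
  show "continuous_map ?X ?X g" if "g \<in> carrier (full_group A)" for g
    using that homeomorphic_imp_continuous_map by (auto simp: carrier_full_group full_group_set_def)
  show "compact_space ?X" "Hausdorff_space ?X"
    using assms compact_markov_space Hausdorff_markov_space by auto
  show "openin ?X (?X closure_of {x \<in> topspace ?X. g x \<noteq> x})" if "g \<in> carrier (full_group A)" for g
    using that openin_support_full_group Hausdorff_markov_space assms by (simp add: carrier_full_group)
  show "\<exists>s\<in>carrier (full_group A). s \<otimes>\<^bsub>full_group A\<^esub> s = \<one>\<^bsub>full_group A\<^esub> \<and> s x \<noteq> x \<and>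
      {y \<in> topspace ?X. s y \<noteq> y} \<subseteq> U" if U: "openin ?X U" "x \<in> U" for U x
  proof -
    obtain s where s: "s \<in> full_group_set A" "\<forall>y\<in>topspace ?X. s (s y) = y" "s x \<noteq> x"
        "{y \<in> topspace ?X. s y \<noteq> y} \<subseteq> U"
      using full_group_swap[OF assms U] by blast
    moreover have "s \<otimes>\<^bsub>full_group A\<^esub> s = \<one>\<^bsub>full_group A\<^esub>"
    proof -
      have "\<one>\<^bsub>full_group A\<^esub> = (\<lambda>x\<in>topspace ?X. x)"
        by (simp add: full_group_def BijGroup_def)
      then show ?thesis
        using s(2) by (simp add: mult_full_group[OF s(1) s(1)] compose_def cong: restrict_cong)
    qed
    ultimately show ?thesis by (auto simp: carrier_full_group)
  qed
qed

text \<open>By equivariance, conjugation by the homeomorphism \<open>point_map\<close> is the given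
  isomorphism \<open>\<psi>\<close> itself, so it carries one full group onto the other.\<close>

lemma spatially_isomorphic_if_iso:
  assumes "zero_one_matrix N A" "irreducible_matrix A" "condition_I A"
    and "zero_one_matrix M B" "irreducible_matrix B" "condition_I B"
    and "full_group A \<cong> full_group B"
  shows "spatially_isomorphic A B"
proof -
  let ?X = "markov_space A" and ?Y = "markov_space B"
  obtain \<psi> \<psi>' where isos: "group_isomorphisms (full_group A) (full_group B) \<psi> \<psi>'"
    using assms(7) group.iso_iff_group_isomorphisms[OF group_full_group] unfolding is_iso_def by blast
  interpret clopen_swap_action_pair "full_group A" ?X "\<lambda>g. g" "full_group B" ?Y "\<lambda>g. g" \<psi> \<psi>'
    by (intro clopen_swap_action_pair.intro clopen_swap_action_full_group group_iso_pair.intro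
        group_full_group group_iso_pair_axioms.intro isos; (rule assms)?)
  have inj: "inj_on point_map (topspace ?X)" and surj: "point_map ` topspace ?X = topspace ?Y"
    using point_map_homeomorphic homeomorphic_imp_injective_map homeomorphic_imp_surjective_map by blast+
  have conj: "conjugate_map ?X ?Y point_map \<tau> = \<psi> \<tau>" if \<tau>: "\<tau> \<in> full_group_set A" for \<tau>
  proof (rule extensionalityI[of _ "topspace ?Y"])
    show "conjugate_map ?X ?Y point_map \<tau> \<in> extensional (topspace ?Y)" by (simp add: conjugate_map_def)
    have "\<psi> \<tau> \<in> full_group_set B" using closed \<tau> by (simp add: carrier_full_group)
    then show "\<psi> \<tau> \<in> extensional (topspace ?Y)" by (simp add: full_group_set_def)
    fix y assume y: "y \<in> topspace ?Y"
    then obtain x where x: "x \<in> topspace ?X" "y = point_map x" using surj by blast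
    then show "conjugate_map ?X ?Y point_map \<tau> y = \<psi> \<tau> y"
      using y point_map_equivariant[of \<tau> x] \<tau> inj by (simp add: conjugate_map_def carrier_full_group)
  qed
  have "\<psi> ` full_group_set A = full_group_set B"
    using closed inverse unfolding carrier_full_group by force
  then have "conjugate_map ?X ?Y point_map ` full_group_set A = full_group_set B"
    using conj by (simp cong: image_cong_simp)
  then show ?thesis unfolding spatially_isomorphic_def using point_map_homeomorphic by blast
qed

lemma iso_if_spatially_isomorphic:
  assumes "spatially_isomorphic A B"
  shows "full_group A \<cong> full_group B"
proof -
  let ?X = "markov_space A" and ?Y = "markov_space B"
  obtain h where h: "homeomorphic_map ?X ?Y h"
    and im: "conjugate_map ?X ?Y h ` full_group_set A = full_group_set B"
    using assms by (auto simp: spatially_isomorphic_def)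
  let ?C = "conjugate_map ?X ?Y h"
  have inj: "inj_on h (topspace ?X)" and surj: "h ` topspace ?X = topspace ?Y"
    using h homeomorphic_imp_injective_map homeomorphic_imp_surjective_map by blast+
  have C: "?C \<tau> (h x) = h (\<tau> x)" if "x \<in> topspace ?X" for \<tau> x
    using that inj surj by (auto simp: conjugate_map_def)
  have closed: "\<tau> x \<in> topspace ?X" if "\<tau> \<in> full_group_set A" "x \<in> topspace ?X" for \<tau> x
    using that full_group_set_subset_Bij by (auto dest!: Bij_imp_funcset)
  have "?C \<in> iso (full_group A) (full_group B)"
  proof (rule isoI)
    show "?C \<in> hom (full_group A) (full_group B)"
    proof (rule homI; unfold carrier_full_group)
      fix f g assume fg: "f \<in> full_group_set A" "g \<in> full_group_set A"
      have "?C (compose (topspace ?X) f g) = compose (topspace ?Y) (?C f) (?C g)"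
      proof (rule extensionalityI[of _ "topspace ?Y"])
        fix y assume "y \<in> topspace ?Y"
        then obtain x where x: "x \<in> topspace ?X" "y = h x" using surj by blast
        then show "?C (compose (topspace ?X) f g) y = compose (topspace ?Y) (?C f) (?C g) y"
          using fg closed surj by (auto simp: C compose_def)
      qed (simp_all add: conjugate_map_def)
      moreover have "?C f \<in> full_group_set B" "?C g \<in> full_group_set B" using fg im by auto
      ultimately show "?C (f \<otimes>\<^bsub>full_group A\<^esub> g) = ?C f \<otimes>\<^bsub>full_group B\<^esub> ?C g"
        using fg by (simp add: mult_full_group)
    qed (use im in auto)
    have "inj_on ?C (full_group_set A)"
    proof (rule inj_onI)
      fix f g assume fg: "f \<in> full_group_set A" "g \<in> full_group_set A" "?C f = ?C g"
      show "f = g"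
      proof (rule extensionalityI[of _ "topspace ?X"])
        fix x assume x: "x \<in> topspace ?X"
        then have "h (f x) = h (g x)" using C fg(3) by metis
        then show "f x = g x" using inj x fg closed by (auto dest: inj_onD)
      qed (use fg in \<open>auto simp: full_group_set_def\<close>)
    qed
    then show "bij_betw ?C (carrier (full_group A)) (carrier (full_group B))"
      using im by (simp add: bij_betw_def carrier_full_group)
  qed
  then show ?thesis by (rule is_isoI)
qed

theorem theorem1p1:
  fixes A B :: "nat mat" and N M :: nat
  assumes "zero_one_matrix N A" and "zero_one_matrix M B"
    and "irreducible_matrix A" and "irreducible_matrix B"
    and "condition_I A" and "condition_I B"
  shows "full_group A \<cong> full_group B \<longleftrightarrow> spatially_isomorphic A B"
  using spatially_isomorphic_if_iso iso_if_spatially_isomorphic assms by blast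

end
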